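(* For $\tau$ in the complex upper half-plane $\mathbb{H}$, put $q=e^{2\pi i\tau}$ and $q^{\alpha}:=e^{2\pi i\alpha\tau}$ for rational $\alpha$. Let \[ \Pi_q:=q^{1/4}\frac{(q^2;q^2)_\infty^2}{(q;q^2)_\infty^2},\qquad \Pi_{q^7}:=q^{7/4}\frac{(q^{14};q^{14})_\infty^2}{(q^{7};q^{14})_\infty^2},\qquad g:=\frac{\Pi_q}{\Pi_{q^7}}, \] \[ z:=\frac{1}{\Pi_{q^7}^2}\left(\sum_{n\ge1}\frac{q^{2n-1}}{(1-q^{2n-1})^2}-7\sum_{n\ge1}\frac{q^{14n-7}}{(1-q^{14n-7})^2}\right), \] \[ w:=4\left(\sum_{n\ge1}\frac{q^{n}}{(1-q^{n})^2}-7\sum_{n\ge1}\frac{q^{7n}}{(1-q^{7n})^2}\right)+1, \] and $f:=w/(\Pi_{q^7}^2 z)$. Then \[ g^2(g^4+4g^2+49)f^3-g^2(2g^4+5g^2+98)f^2-2g^2(5g^4+22g^2+245)f-(g^2-4g+7)^2(g^2+4g+7)^2=0. \]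
   Context: For a complex number $a$, $(a;q)_\infty:=\prod_{n=0}^\infty(1-aq^n)$. *)

theory Defs
  imports "HOL-Analysis.Analysis"
begin

definition qpochhammer_inf :: "complex \<Rightarrow> complex \<Rightarrow> complex" where
  "qpochhammer_inf a q = (\<Prod>n. 1 - a * q ^ n)"

text \<open>
  Fractional powers of \<open>q\<close> are functions of \<open>\<tau>\<close>, not of \<open>q\<close>: using \<open>powr\<close> on the value \<open>q\<close> would
  select the principal branch, which differs from \<open>exp (2\<pi>i\<alpha>\<tau>)\<close> once \<open>Re \<tau>\<close> leaves the
  interval from \<open>-1/2\<close> to \<open>1/2\<close>.
\<close>

definition qpow :: "rat \<Rightarrow> complex \<Rightarrow> complex" where
  "qpow \<alpha> \<tau> = exp (2 * of_real pi * \<i> * of_rat \<alpha> * \<tau>)"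

definition nome :: "complex \<Rightarrow> complex" where
  "nome \<tau> = exp (2 * of_real pi * \<i> * \<tau>)"

definition Pi_q :: "complex \<Rightarrow> complex" where
  "Pi_q \<tau> = (let q = nome \<tau> in
     qpow (1/4) \<tau> * ((qpochhammer_inf (q^2) (q^2))\<^sup>2 / (qpochhammer_inf q (q^2))\<^sup>2))"

definition Pi_q7 :: "complex \<Rightarrow> complex" where
  "Pi_q7 \<tau> = (let q = nome \<tau> in
     qpow (7/4) \<tau> * ((qpochhammer_inf (q^14) (q^14))\<^sup>2 / (qpochhammer_inf (q^7) (q^14))\<^sup>2))"

definition g_fun :: "complex \<Rightarrow> complex" where
  "g_fun \<tau> = Pi_q \<tau> / Pi_q7 \<tau>"

definition z_fun :: "complex \<Rightarrow> complex" where
  "z_fun \<tau> = (let q = nome \<tau> in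
     1 / (Pi_q7 \<tau>)\<^sup>2 *
       ((\<Sum>\<^sub>\<infinity>n\<in>{1::nat..}. q ^ (2*n - 1) / (1 - q ^ (2*n - 1))\<^sup>2)
        - 7 * (\<Sum>\<^sub>\<infinity>n\<in>{1::nat..}. q ^ (14*n - 7) / (1 - q ^ (14*n - 7))\<^sup>2)))"

definition w_fun :: "complex \<Rightarrow> complex" where
  "w_fun \<tau> = (let q = nome \<tau> in
     4 * ((\<Sum>\<^sub>\<infinity>n\<in>{1::nat..}. q ^ n / (1 - q ^ n)\<^sup>2)
        - 7 * (\<Sum>\<^sub>\<infinity>n\<in>{1::nat..}. q ^ (7*n) / (1 - q ^ (7*n))\<^sup>2)) + 1)"

text \<open>
  The function \<open>z_fun\<close> has zeros in the upper half-plane, and \<open>f_fun\<close> is meaningful only away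
  from them; at such a zero HOL's division by zero returns \<open>0\<close>.
\<close>

definition f_fun :: "complex \<Rightarrow> complex" where
  "f_fun \<tau> = w_fun \<tau> / ((Pi_q7 \<tau>)\<^sup>2 * z_fun \<tau>)"

end

theory Submission
  imports Defs "HOL-Complex_Analysis.Complex_Analysis"
begin

text \<open>
  Put \<open>x = exp (\<pi>i\<tau>)\<close>, so that \<open>q = x\<^sup>2\<close>, and let \<open>\<psi>(x)\<close> be the sum of \<open>x\<^bsup>n(n+1)/2\<^esup>\<close> over \<open>n \<ge> 0\<close>,
  which is also the sum of \<open>x\<^bsup>a(2a+1)\<^esup>\<close> over all integers \<open>a\<close>. By Gauss's product
  \<open>\<Pi>\<^sub>q\<^sup>2 = x \<psi>(x\<^sup>2)\<^sup>4\<close>, and the Lambert series in \<open>w\<close> and \<open>z\<close> are logarithmic derivatives of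
  products of values of \<open>\<psi>\<close>. With \<open>\<alpha> = 16x \<psi>(x\<^sup>2)\<^sup>8 / \<psi>(x)\<^sup>8\<close>, \<open>\<beta> = \<alpha>(x\<^sup>7)\<close> and
  \<open>t = 2x \<psi>(x\<^sup>2) \<psi>(x\<^bsup>14\<^esup>) / (\<psi>(x) \<psi>(x\<^sup>7))\<close>, a rearrangement of the double series of
  \<open>\<psi>(x) \<psi>(x\<^sup>7)\<close> gives the modular equation \<open>\<alpha>\<beta> = t\<^sup>8\<close>, \<open>(1 - \<alpha>)(1 - \<beta>) = (1 - t)\<^sup>8\<close>.
  Landen's transformation gives \<open>x d\<alpha>/dx = \<alpha>(1 - \<alpha>) \<theta>\<^sub>3(x)\<^sup>4\<close>. Differentiating the modular equation
  then expresses the multiplier \<open>m = \<theta>\<^sub>3(x)\<^sup>2 / \<theta>\<^sub>3(x\<^sup>7)\<^sup>2\<close> through \<open>t\<close> and \<open>\<beta>\<close>, and eliminating \<open>\<beta>\<close> leaves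
  \<open>7/m - m = 6 - 16t + 12t\<^sup>2 - 8t\<^sup>3\<close>. On this curve
  \<open>f = 16(1 - t + t\<^sup>2)\<^sup>2 / (t\<^sup>2(4 - 4t + 3t\<^sup>2))\<close> and
  \<open>g\<^sup>2 + 49/g\<^sup>2 = 14 + 4(4 - 6t + 8t\<^sup>2 - 3t\<^sup>3)\<^sup>2 / t\<^sup>6\<close>, so the claim becomes an identity in \<open>t\<close>.
\<close>

subsection \<open>Series identities for theta functions\<close>

text \<open>For complex families summability is absolute, so the products of norms are summable over
  the rectangle and the iterated sum gives the value.\<close>

lemma has_sum_mult:
  fixes f :: "'a \<Rightarrow> complex" and g :: "'b \<Rightarrow> complex"
  assumes f: "(f has_sum a) A" and g: "(g has_sum b) B"
  shows "((\<lambda>(x, y). f x * g y) has_sum (a * b)) (A \<times> B)"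
proof (rule has_sum_SigmaI)
  show "((\<lambda>y. case (x, y) of (x, y) \<Rightarrow> f x * g y) has_sum f x * b) B" for x
    using has_sum_cmult_right[OF g, of "f x"] by simp
  show "((\<lambda>x. f x * b) has_sum a * b) A"
    by (rule has_sum_cmult_left[OF f])
  have nf: "(\<lambda>x. norm (f x)) summable_on A" and ng: "(\<lambda>y. norm (g y)) summable_on B"
    using has_sum_imp_summable[OF f] has_sum_imp_summable[OF g]
    by (simp_all only: summable_on_iff_abs_summable_on_complex)
  have "(\<lambda>(x, y). norm (f x) * norm (g y)) summable_on A \<times> B"
  proof (rule summable_on_SigmaI)
    show "((\<lambda>y. case (x, y) of (x, y) \<Rightarrow> norm (f x) * norm (g y)) has_sum
        norm (f x) * infsum (\<lambda>y. norm (g y)) B) B" for x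
      using has_sum_cmult_right[OF has_sum_infsum[OF ng], of "norm (f x)"] by simp
    show "(\<lambda>x. norm (f x) * infsum (\<lambda>y. norm (g y)) B) summable_on A"
      by (rule summable_on_cmult_left[OF nf])
  qed auto
  then have "(\<lambda>z. norm (case z of (x, y) \<Rightarrow> f x * g y)) summable_on A \<times> B"
    by (simp add: case_prod_unfold norm_mult)
  then show "(\<lambda>(x, y). f x * g y) summable_on A \<times> B"
    by (rule abs_summable_summable)
qed

section \<open>Theta series indexed by the integers\<close>

lemma summable_on_int_power_abs:
  fixes r :: real
  assumes "0 \<le> r" "r < 1"
  shows "(\<lambda>n. r ^ nat \<bar>n\<bar>) summable_on UNIV"
proof -
  have geo: "(\<lambda>n. r ^ n) summable_on UNIV"
    using assms by (intro norm_summable_imp_summable_on) (auto simp: summable_geometric_iff)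
  have "(\<lambda>n. r ^ nat \<bar>n\<bar>) summable_on range int"
    using geo by (subst summable_on_reindex) (auto simp: o_def)
  moreover have "(\<lambda>n. r ^ nat \<bar>n\<bar>) summable_on range (\<lambda>n. - int n)"
    using geo by (subst summable_on_reindex) (auto simp: o_def inj_def)
  ultimately have "(\<lambda>n. r ^ nat \<bar>n\<bar>) summable_on (range int \<union> range (\<lambda>n. - int n))"
    by (rule summable_on_union)
  moreover have "range int \<union> range (\<lambda>n. - int n) = UNIV"
  proof -
    have "n \<in> range int \<union> range (\<lambda>n. - int n)" for n
      by (cases n rule: int_cases2) auto
    then show ?thesis by auto
  qed
  ultimately show ?thesis by simp
qed

text \<open>As \<open>n\<close> runs over all integers, \<open>tri n\<close> takes each triangular
  number exactly once. The two-sided index lets products of such series be rearranged by affine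
  changes of variables.\<close>

definition tri :: "int \<Rightarrow> int" where "tri n = n * (2 * n + 1)"

definition psi :: "complex \<Rightarrow> complex" where
  "psi x = (\<Sum>\<^sub>\<infinity>n. x ^ nat (tri n))"

text \<open>Jacobi's theta_3 with nome \<open>x\<close>; \<open>phi (- x)\<close> is
  theta_4.\<close>

definition phi :: "complex \<Rightarrow> complex" where
  "phi x = (\<Sum>\<^sub>\<infinity>n::int. x ^ nat (n\<^sup>2))"

lemma abs_le_square: "\<bar>n\<bar> \<le> n\<^sup>2" for n :: int
proof (cases "n = 0")
  case False
  then show ?thesis
    using self_le_power[of "\<bar>n\<bar>" 2] by simp
qed simp

lemma abs_le_tri: "\<bar>n\<bar> \<le> tri n"
proof -
  have "n + n\<^sup>2 \<ge> 0" using abs_le_square[of n] by linarith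
  then show ?thesis
    using abs_le_square[of n] by (simp add: tri_def power2_eq_square algebra_simps abs_le_iff)
qed

lemma tri_nonneg: "0 \<le> tri n"
  using abs_le_tri[of n] by linarith

lemma summable_on_int_power:
  fixes x :: complex
  assumes "norm x < 1" "\<And>n. \<bar>n\<bar> \<le> e n"
  shows "(\<lambda>n::int. x ^ nat (e n)) summable_on UNIV"
proof (rule abs_summable_summable, rule summable_on_comparison_test)
  show "(\<lambda>n. norm x ^ nat \<bar>n\<bar>) summable_on UNIV"
    using assms(1) by (intro summable_on_int_power_abs) auto
  show "norm (x ^ nat (e n)) \<le> norm x ^ nat \<bar>n\<bar>" for n
    unfolding norm_power
    by (rule power_decreasing[OF nat_mono[OF assms(2)]]) (use assms(1) in simp_all)
qed simp

lemma has_sum_psi: "norm x < 1 \<Longrightarrow> ((\<lambda>n. x ^ nat (tri n)) has_sum psi x) UNIV"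
  unfolding psi_def by (rule has_sum_infsum[OF summable_on_int_power[OF _ abs_le_tri]])

lemma has_sum_phi: "norm x < 1 \<Longrightarrow> ((\<lambda>n::int. x ^ nat (n\<^sup>2)) has_sum phi x) UNIV"
  unfolding phi_def by (rule has_sum_infsum[OF summable_on_int_power[OF _ abs_le_square]])

lemma power_nat_add: "0 \<le> u \<Longrightarrow> 0 \<le> v \<Longrightarrow> x ^ nat u * x ^ nat v = (x::complex) ^ nat (u + v)"
  by (simp add: nat_add_distrib power_add)

lemma power_nat_mult: "0 \<le> u \<Longrightarrow> (x ^ k) ^ nat u = (x::complex) ^ nat (int k * u)"
  by (simp add: nat_mult_distrib power_mult)

lemma norm_power_less_one: "norm x < 1 \<Longrightarrow> 0 < k \<Longrightarrow> norm (x ^ k :: complex) < 1"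
  by (simp add: norm_power power_less_one_iff)

text \<open>With \<open>s = a + b\<close>, \<open>tri a + tri b = (a - b)^2 + (s^2 + s)\<close>. The
  last summand is invariant under \<open>s \<mapsto> -1 - s\<close>, which changes parity; so an odd
  \<open>s\<close> can be replaced by an even one, and \<open>s = 2 * m\<close> turns it into
  \<open>2 * tri m\<close>.\<close>

lemma psi_square:
  assumes x: "norm x < 1"
  shows "psi x ^ 2 = phi x * psi (x ^ 2)"
proof -
  have l: "((\<lambda>(a, b). x ^ nat (tri a) * x ^ nat (tri b)) has_sum psi x * psi x) (UNIV \<times> UNIV)"
    by (intro has_sum_mult has_sum_psi x)
  have r: "((\<lambda>(n, m). x ^ nat (n\<^sup>2) * (x ^ 2) ^ nat (tri m)) has_sum phi x * psi (x ^ 2)) (UNIV \<times> UNIV)"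
    by (intro has_sum_mult has_sum_psi has_sum_phi norm_power_less_one x) auto
  have lr: "((\<lambda>(a, b). x ^ nat (tri a) * x ^ nat (tri b)) has_sum psi x * psi x) (UNIV \<times> UNIV)
     = ((\<lambda>(n, m). x ^ nat (n\<^sup>2) * (x ^ 2) ^ nat (tri m)) has_sum psi x * psi x) (UNIV \<times> UNIV)"
  proof (rule has_sum_reindex_bij_witness[where
        j = "\<lambda>(a, b). (a - b, if even (a + b) then (a + b) div 2 else - ((a + b + 1) div 2))" and
        i = "\<lambda>(n, m). if even n then ((2 * m + n) div 2, (2 * m - n) div 2)
               else ((- 2 * m - 1 + n) div 2, (- 2 * m - 1 - n) div 2)"], goal_cases)
    case (1 ab)
    obtain a b where ab: "ab = (a, b)" by force
    show ?case
    proof (cases "even (a + b)")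
      case True
      then obtain k where "a + b = 2 * k" by blast
      then have "b = 2 * k - a" by simp
      then show ?thesis by (simp add: ab)
    next
      case False
      then obtain k where "a + b = 2 * k + 1" by (rule oddE)
      then have "b = 2 * k + 1 - a" by simp
      then show ?thesis by (simp add: ab)
    qed
  next
    case (3 nm)
    obtain n m where nm: "nm = (n, m)" by force
    show ?case
    proof (cases "even n")
      case True
      then obtain k where "n = 2 * k" by blast
      then show ?thesis by (simp add: nm)
    next
      case False
      then obtain k where n: "n = 2 * k + 1" by (rule oddE)
      have "(- 2 * m - 1 + n) div 2 = k - m" "(- 2 * m - 1 - n) div 2 = - m - k - 1"
        "k - m - (- m - k - 1) = n" "odd (k - m + (- m - k - 1))"
        "- ((k - m + (- m - k - 1) + 1) div 2) = m"
        unfolding n by presburger+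
      then show ?thesis using False by (simp only: nm prod.case if_False)
    qed
  next
    case (5 ab)
    obtain a b where ab: "ab = (a, b)" by force
    define m where "m = (if even (a + b) then (a + b) div 2 else - ((a + b + 1) div 2))"
    have "(a - b)\<^sup>2 + 2 * tri m = tri a + tri b"
    proof (cases "even (a + b)")
      case True
      then have b: "b = 2 * m - a" by (simp add: m_def)
      show ?thesis unfolding b tri_def by algebra
    next
      case False
      then have "m = - ((a + b + 1) div 2)" by (simp only: m_def if_False)
      with False have b: "b = - 2 * m - 1 - a" by presburger
      show ?thesis unfolding b tri_def by algebra
    qed
    then have "x ^ nat ((a - b)\<^sup>2) * (x\<^sup>2) ^ nat (tri m) = x ^ nat (tri a) * x ^ nat (tri b)"
      by (simp only: power_nat_mult power_nat_add tri_nonneg zero_le_power2 of_nat_numeral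
          mult_nonneg_nonneg zero_le_numeral)
    then show ?case
      unfolding ab m_def by (simp only: prod.case)
  qed auto
  show ?thesis
    using has_sum_unique[OF l[unfolded lr] r] by (simp only: power2_eq_square)
qed

text \<open>The even \<open>n = 2 * m\<close> and the odd \<open>n = - 2 * m - 1\<close> both have
  \<open>n^2 + n = 2 * tri m\<close>, whence the factor 2.\<close>

lemma has_sum_int_square_plus:
  assumes x: "norm x < 1"
  shows "((\<lambda>n::int. x ^ nat (n\<^sup>2 + n)) has_sum 2 * psi (x ^ 2)) UNIV"
proof -
  have ps: "((\<lambda>n. (x ^ 2) ^ nat (tri n)) has_sum psi (x ^ 2)) UNIV"
    by (intro has_sum_psi norm_power_less_one x) auto
  have ev: "(2 * m)\<^sup>2 + 2 * m = 2 * tri m" "(- 2 * m - 1)\<^sup>2 + (- 2 * m - 1) = 2 * tri m" for m :: int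
    by (auto simp: tri_def power2_eq_square algebra_simps)
  have "((\<lambda>n. (x ^ 2) ^ nat (tri n)) has_sum psi (x ^ 2)) UNIV =
        ((\<lambda>n::int. x ^ nat (n\<^sup>2 + n)) has_sum psi (x ^ 2)) {n. even n}"
  proof (rule has_sum_reindex_bij_witness[where j = "\<lambda>m. 2 * m" and i = "\<lambda>n. n div 2"], goal_cases)
    case (5 m)
    show ?case by (simp only: ev power_nat_mult tri_nonneg of_nat_numeral)
  qed auto
  moreover have "((\<lambda>n. (x ^ 2) ^ nat (tri n)) has_sum psi (x ^ 2)) UNIV =
        ((\<lambda>n::int. x ^ nat (n\<^sup>2 + n)) has_sum psi (x ^ 2)) {n. odd n}"
  proof (rule has_sum_reindex_bij_witness[where j = "\<lambda>m. - 2 * m - 1" and i = "\<lambda>n. (- n - 1) div 2"], goal_cases)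
    case (3 n)
    then have "odd n" by simp
    then obtain k where "n = 2 * k + 1" by (rule oddE)
    then show ?case by simp
  next
    case (5 m)
    show ?case by (simp only: ev power_nat_mult tri_nonneg of_nat_numeral)
  qed auto
  ultimately have "((\<lambda>n::int. x ^ nat (n\<^sup>2 + n)) has_sum (psi (x ^ 2) + psi (x ^ 2))) ({n. even n} \<union> {n. odd n})"
    using ps by (intro has_sum_Un_disjoint) auto
  moreover have "{n::int. even n} \<union> {n. odd n} = UNIV" by auto
  ultimately show ?thesis by simp
qed

text \<open>Split the pairs \<open>(a, b)\<close> by the parity of \<open>a + b\<close>. For
  \<open>(s + d, s - d)\<close> the exponent is \<open>2 * s^2 + 2 * d^2\<close>; for
  \<open>(s + d + 1, s - d)\<close> it is \<open>1 + 2 * (s^2 + s) + 2 * (d^2 + d)\<close>.\<close>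

lemma phi_square:
  assumes x: "norm x < 1"
  shows "phi x ^ 2 = phi (x ^ 2) ^ 2 + 4 * x * psi (x ^ 4) ^ 2"
proof -
  define F where "F = (\<lambda>(a::int, b::int). x ^ nat (a\<^sup>2) * x ^ nat (b\<^sup>2))"
  have x2: "norm (x ^ 2) < 1" by (intro norm_power_less_one x) auto
  have F: "(F has_sum phi x * phi x) (UNIV \<times> UNIV)"
    unfolding F_def by (intro has_sum_mult has_sum_phi x)
  have "((\<lambda>(s::int, d::int). (x ^ 2) ^ nat (s\<^sup>2) * (x ^ 2) ^ nat (d\<^sup>2)) has_sum phi (x ^ 2) * phi (x ^ 2)) (UNIV \<times> UNIV)"
    by (intro has_sum_mult has_sum_phi x2)
  also have "?this \<longleftrightarrow> (F has_sum phi (x ^ 2) * phi (x ^ 2)) {(a, b). even (a + b)}"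
  proof (rule has_sum_reindex_bij_witness[where
        j = "\<lambda>(s, d). (s + d, s - d)" and i = "\<lambda>(a, b). ((a + b) div 2, (a - b) div 2)"], goal_cases)
    case (5 sd)
    obtain s d where sd: "sd = (s, d)" by force
    have "(s + d)\<^sup>2 + (s - d)\<^sup>2 = 2 * s\<^sup>2 + 2 * d\<^sup>2"
      by (simp add: power2_eq_square algebra_simps)
    then show ?case
      by (simp only: sd F_def prod.case power_nat_mult power_nat_add zero_le_power2 of_nat_numeral
          mult_nonneg_nonneg zero_le_numeral)
  qed (simp_all add: case_prod_unfold split_beta prod_eq_iff, presburger+)
  finally have ev: "(F has_sum phi (x ^ 2) * phi (x ^ 2)) {(a, b). even (a + b)}" .
  have nn: "0 \<le> s\<^sup>2 + s" for s :: int using abs_le_square[of s] by linarith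
  have "((\<lambda>sd. x * (case sd of (s::int, d::int) \<Rightarrow> (x ^ 2) ^ nat (s\<^sup>2 + s) * (x ^ 2) ^ nat (d\<^sup>2 + d)))
      has_sum x * (2 * psi ((x ^ 2) ^ 2) * (2 * psi ((x ^ 2) ^ 2)))) (UNIV \<times> UNIV)"
    by (intro has_sum_cmult_right has_sum_mult has_sum_int_square_plus x2)
  also have "?this \<longleftrightarrow> (F has_sum x * (2 * psi ((x ^ 2) ^ 2) * (2 * psi ((x ^ 2) ^ 2)))) {(a, b). odd (a + b)}"
  proof (rule has_sum_reindex_bij_witness[where
        j = "\<lambda>(s, d). (s + d + 1, s - d)" and i = "\<lambda>(a, b). ((a + b - 1) div 2, (a - b - 1) div 2)"], goal_cases)
    case (5 sd)
    obtain s d where sd: "sd = (s, d)" by force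
    have e: "(s + d + 1)\<^sup>2 + (s - d)\<^sup>2 = 1 + (2 * (s\<^sup>2 + s) + 2 * (d\<^sup>2 + d))"
      by (simp add: power2_eq_square algebra_simps)
    have "F (s + d + 1, s - d) = x ^ nat (1 + (2 * (s\<^sup>2 + s) + 2 * (d\<^sup>2 + d)))"
      by (simp only: F_def prod.case power_nat_add zero_le_power2 e)
    also have "\<dots> = x ^ nat 1 * (x ^ nat (2 * (s\<^sup>2 + s)) * x ^ nat (2 * (d\<^sup>2 + d)))"
      by (simp only: power_nat_add nn mult_nonneg_nonneg zero_le_numeral add_nonneg_nonneg zero_le_one)
    also have "\<dots> = x * ((x\<^sup>2) ^ nat (s\<^sup>2 + s) * (x\<^sup>2) ^ nat (d\<^sup>2 + d))"
      by (simp only: power_nat_mult nn of_nat_numeral nat_one_as_int[symmetric]) simp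
    finally show ?case by (simp only: sd prod.case)
  qed (simp_all add: case_prod_unfold split_beta prod_eq_iff, presburger+)
  finally have "(F has_sum (phi (x ^ 2) * phi (x ^ 2) + x * (2 * psi ((x ^ 2) ^ 2) * (2 * psi ((x ^ 2) ^ 2)))))
      ({(a, b). even (a + b)} \<union> {(a, b). odd (a + b)})"
    by (intro has_sum_Un_disjoint ev) auto
  moreover have "{(a, b). even (a + b)} \<union> {(a, b). odd (a + b)} = (UNIV \<times> UNIV :: (int \<times> int) set)" by auto
  ultimately have F': "(F has_sum (phi (x ^ 2) * phi (x ^ 2) + x * (2 * psi ((x ^ 2) ^ 2) * (2 * psi ((x ^ 2) ^ 2)))))
      (UNIV \<times> UNIV)" by simp
  have "(x ^ 2) ^ 2 = x ^ 4" by simp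
  then show ?thesis
    using has_sum_unique[OF F F'] by (simp add: power2_eq_square[of "phi _"] power2_eq_square[of "psi _"])
qed

text \<open>
  With \<open>X = 4a + 1\<close> and \<open>Y = 4b + 1\<close>, the exponents on the left are \<open>(X\<^sup>2 + 7Y\<^sup>2 - 8)/8\<close>. The odd ones are
  those with \<open>a + b\<close> odd, and then division of \<open>X + Y\<surd>-7\<close> by \<open>(1 + \<surd>-7)/2\<close> maps \<open>(X, Y)\<close> to
  \<open>((X + 7Y)/4, (Y - X)/4)\<close>, which up to a common sign has the form \<open>(4m + 1, 4n + 1)\<close>.
\<close>

lemma psi_degree_seven:
  assumes x: "norm x < 1"
  shows "psi x * psi (x ^ 7) - psi (- x) * psi ((- x) ^ 7) = 2 * x * psi (x ^ 2) * psi (x ^ 14)"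
proof -
  define e where "e = (\<lambda>ab. nat (tri (fst ab) + 7 * tri (snd ab)))"
  have sums: "((\<lambda>ab. y ^ e ab) has_sum psi y * psi (y ^ 7)) (UNIV \<times> UNIV)"
    if y: "norm y < 1" for y
  proof -
    have "norm (y ^ 7) < 1" by (rule norm_power_less_one[OF y]) simp
    then have "((\<lambda>(a, b). y ^ nat (tri a) * (y ^ 7) ^ nat (tri b)) has_sum psi y * psi (y ^ 7)) (UNIV \<times> UNIV)"
      by (rule has_sum_mult[OF has_sum_psi[OF y] has_sum_psi])
    moreover have "(\<lambda>(a, b). y ^ nat (tri a) * (y ^ 7) ^ nat (tri b)) = (\<lambda>ab. y ^ e ab)"
      by (simp add: fun_eq_iff e_def power_nat_mult power_nat_add tri_nonneg)
    ultimately show ?thesis by simp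
  qed
  have mx: "norm (- x) < 1" using x by simp
  \<comment> \<open>Since \<open>tri a\<close> and \<open>a\<close> have the same parity, replacing
    \<open>x\<close> by \<open>- x\<close> changes the sign of exactly the terms with
    \<open>a + b\<close> odd. The difference below keeps these, doubled.\<close>
  have par: "even (e ab) \<longleftrightarrow> even (fst ab + snd ab)" for ab
    using tri_nonneg[of "fst ab"] tri_nonneg[of "snd ab"] by (simp add: e_def even_nat_iff) (simp add: tri_def)
  have "((\<lambda>ab. x ^ e ab - (- x) ^ e ab) has_sum (psi x * psi (x ^ 7) - psi (- x) * psi ((- x) ^ 7))) (UNIV \<times> UNIV)"
    using has_sum_add[OF sums[OF x] has_sum_cmult_right[OF sums[OF mx], of "- 1"]] by simp
  also have "?this \<longleftrightarrow> ((\<lambda>ab. 2 * x ^ e ab)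
      has_sum (psi x * psi (x ^ 7) - psi (- x) * psi ((- x) ^ 7))) {ab. odd (fst ab + snd ab)}"
    by (rule has_sum_cong_neutral) (auto simp: par uminus_power_if)
  also have "\<dots> \<longleftrightarrow> ((\<lambda>(m, n). 2 * x * ((x ^ 2) ^ nat (tri m) * (x ^ 14) ^ nat (tri n)))
      has_sum (psi x * psi (x ^ 7) - psi (- x) * psi ((- x) ^ 7))) (UNIV \<times> UNIV)"
  \<comment> \<open>As \<open>a + b\<close> is odd, \<open>b - a\<close> is 1 or 3 modulo 4, and
    this residue decides the common sign. In the inverse map the parity of \<open>m + n\<close>
    decides it.\<close>
  proof (rule has_sum_reindex_bij_witness[where
        j = "\<lambda>(a, b). if (b - a) mod 4 = 1 then ((a + 7 * b + 1) div 4, (b - a - 1) div 4)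
               else (- ((a + 7 * b + 3) div 4), - ((b - a + 1) div 4))" and
        i = "\<lambda>(m, n). if even (m + n) then ((m - 7 * n - 2) div 2, (m + n) div 2)
               else ((7 * n - m + 1) div 2, - ((m + n + 1) div 2))"], goal_cases)
    case (1 ab)
    obtain a b where ab: "ab = (a, b)" by force
    have odd: "odd (a + b)" using 1 by (simp add: ab)
    show ?case
    proof (cases "(b - a) mod 4 = 1")
      case True
      define k where "k = (b - a) div 4"
      have b: "b = a + 4 * k + 1" using True div_mult_mod_eq[of "b - a" 4] unfolding k_def by linarith
      have "(a + 7 * b + 1) div 4 = 2 * a + 7 * k + 2" "(b - a - 1) div 4 = k"
        unfolding b by presburger+
      moreover have "even (2 * a + 7 * k + 2 + k)" "(2 * a + 7 * k + 2 - 7 * k - 2) div 2 = a"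
        "(2 * a + 7 * k + 2 + k) div 2 = b" unfolding b by presburger+
      ultimately show ?thesis using True by (simp only: ab prod.case if_True simp_thms)
    next
      case False
      define k where "k = (b - a) div 4"
      have "(b - a) mod 4 = 3" using False odd by presburger
      then have b: "b = a + 4 * k + 3" using div_mult_mod_eq[of "b - a" 4] unfolding k_def by linarith
      have "(a + 7 * b + 3) div 4 = 2 * a + 7 * k + 6" "(b - a + 1) div 4 = k + 1"
        unfolding b by presburger+
      moreover have "odd (- (2 * a + 7 * k + 6) + - (k + 1))"
        "(7 * - (k + 1) - - (2 * a + 7 * k + 6) + 1) div 2 = a"
        "- ((- (2 * a + 7 * k + 6) + - (k + 1) + 1) div 2) = b" unfolding b by presburger+
      ultimately show ?thesis using False by (simp only: ab prod.case if_False simp_thms)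
    qed
  next
    case (3 mn)
    obtain m n where mn: "mn = (m, n)" by force
    show ?case
    proof (cases "even (m + n)")
      case True
      then obtain k where "m + n = 2 * k" by blast
      then have n: "n = 2 * k - m" by simp
      have "(m - 7 * n - 2) div 2 = 4 * m - 7 * k - 1" "(m + n) div 2 = k"
        unfolding n by presburger+
      moreover have "(k - (4 * m - 7 * k - 1)) mod 4 = 1"
        "(4 * m - 7 * k - 1 + 7 * k + 1) div 4 = m"
        "(k - (4 * m - 7 * k - 1) - 1) div 4 = n" unfolding n by presburger+
      ultimately show ?thesis using True by (simp only: mn prod.case if_True simp_thms)
    next
      case False
      then obtain k where "m + n = 2 * k + 1" by (rule oddE)
      then have n: "n = 2 * k + 1 - m" by simp
      have "(7 * n - m + 1) div 2 = 7 * k + 4 - 4 * m" "(m + n + 1) div 2 = k + 1"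
        unfolding n by presburger+
      moreover have "(- (k + 1) - (7 * k + 4 - 4 * m)) mod 4 \<noteq> 1"
        "- ((7 * k + 4 - 4 * m + 7 * - (k + 1) + 3) div 4) = m"
        "- ((- (k + 1) - (7 * k + 4 - 4 * m) + 1) div 4) = n" unfolding n by presburger+
      ultimately show ?thesis using False by (simp only: mn prod.case if_False simp_thms)
    qed
  next
    case (4 mn)
    obtain m n where mn: "mn = (m, n)" by force
    show ?case
    proof (cases "even (m + n)")
      case True
      then obtain k where "m + n = 2 * k" by blast
      then have n: "n = 2 * k - m" by simp
      have "(m - 7 * n - 2) div 2 = 4 * m - 7 * k - 1" "(m + n) div 2 = k"
        unfolding n by presburger+
      then show ?thesis using True by (simp only: mn prod.case if_True mem_Collect_eq fst_conv snd_conv) presburger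
    next
      case False
      then obtain k where "m + n = 2 * k + 1" by (rule oddE)
      then have n: "n = 2 * k + 1 - m" by simp
      have "(7 * n - m + 1) div 2 = 7 * k + 4 - 4 * m" "(m + n + 1) div 2 = k + 1"
        unfolding n by presburger+
      then show ?thesis using False by (simp only: mn prod.case if_False mem_Collect_eq fst_conv snd_conv) presburger
    qed
  next
    case (5 ab)
    obtain a b where ab: "ab = (a, b)" by force
    have odd: "odd (a + b)" using 5 by (simp add: ab)
    define m where "m = (if (b - a) mod 4 = 1 then (a + 7 * b + 1) div 4 else - ((a + 7 * b + 3) div 4))"
    define n where "n = (if (b - a) mod 4 = 1 then (b - a - 1) div 4 else - ((b - a + 1) div 4))"
    have j: "(if (b - a) mod 4 = 1 then ((a + 7 * b + 1) div 4, (b - a - 1) div 4)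
               else (- ((a + 7 * b + 3) div 4), - ((b - a + 1) div 4))) = (m, n)"
      by (simp add: m_def n_def)
    have "tri a + 7 * tri b = 1 + (2 * tri m + 14 * tri n)"
    proof (cases "(b - a) mod 4 = 1")
      case True
      then have mn: "m = (a + 7 * b + 1) div 4" "n = (b - a - 1) div 4"
        by (simp_all only: m_def n_def if_True simp_thms)
      have b: "b = a + 4 * n + 1" using True mn(2) by presburger
      have "(a + 7 * b + 1) div 4 = 2 * a + 7 * n + 2" unfolding b by presburger
      then have m: "m = 2 * a + 7 * n + 2" using mn(1) by simp
      show ?thesis unfolding m unfolding b tri_def by algebra
    next
      case False
      then have mn: "m = - ((a + 7 * b + 3) div 4)" "n = - ((b - a + 1) div 4)"
        by (simp_all only: m_def n_def if_False simp_thms)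
      have "(b - a) mod 4 = 3" using False odd by presburger
      then have b: "b = a - 4 * n - 1" using mn(2) by presburger
      have "(a + 7 * b + 3) div 4 = 2 * a - 7 * n - 1" unfolding b by presburger
      then have m: "m = - 2 * a + 7 * n + 1" using mn(1) by simp
      show ?thesis unfolding m unfolding b tri_def by algebra
    qed
    then have "x ^ e ab = x ^ nat (1 + (2 * tri m + 14 * tri n))"
      by (simp add: e_def ab)
    also have "\<dots> = x ^ nat 1 * (x ^ nat (2 * tri m) * x ^ nat (14 * tri n))"
      by (simp only: power_nat_add tri_nonneg mult_nonneg_nonneg zero_le_numeral add_nonneg_nonneg zero_le_one)
    also have "\<dots> = x * ((x ^ 2) ^ nat (tri m) * (x ^ 14) ^ nat (tri n))"
      by (simp only: power_nat_mult tri_nonneg of_nat_numeral) simp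
    finally show ?case by (simp only: ab prod.case j mult.assoc)
  qed (simp_all only: UNIV_Times_UNIV UNIV_I)
  finally have l: "((\<lambda>(m, n). 2 * x * ((x ^ 2) ^ nat (tri m) * (x ^ 14) ^ nat (tri n)))
      has_sum (psi x * psi (x ^ 7) - psi (- x) * psi ((- x) ^ 7))) (UNIV \<times> UNIV)" .
  have "norm (x ^ 2) < 1" "norm (x ^ 14) < 1" by (rule norm_power_less_one[OF x], simp)+
  then have "((\<lambda>(m, n). (x ^ 2) ^ nat (tri m) * (x ^ 14) ^ nat (tri n)) has_sum psi (x ^ 2) * psi (x ^ 14)) (UNIV \<times> UNIV)"
    by (intro has_sum_mult has_sum_psi)
  from has_sum_cmult_right[OF this, of "2 * x"]
  have r: "((\<lambda>(m, n). 2 * x * ((x ^ 2) ^ nat (tri m) * (x ^ 14) ^ nat (tri n))) has_sum 2 * x * (psi (x ^ 2) * psi (x ^ 14))) (UNIV \<times> UNIV)"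
    by (simp only: case_prod_unfold)
  show ?thesis using has_sum_unique[OF l r] by (simp only: mult.assoc)
qed

subsection \<open>The Euler product and Lambert series\<close>

text \<open>Euler's function, the product of \<open>1 - x ^ n\<close> over \<open>n \<ge> 1\<close>;
  both \<open>psi\<close> and the Lambert series are expressed through it.\<close>

definition euler :: "complex \<Rightarrow> complex" where
  "euler x = qpochhammer_inf x x"

lemma power_neq_one:
  fixes x :: complex
  assumes "norm x < 1" "0 < n"
  shows "x ^ n \<noteq> 1"
  using norm_power_less_one[OF assms] by fastforce

section \<open>Convergence and holomorphy of the infinite products\<close>

lemma convergent_prod_qpochhammer:
  fixes a q :: complex
  assumes "norm q < 1"
  shows "convergent_prod (\<lambda>n. 1 - a * q ^ n)"
proof (rule abs_convergent_prod_imp_convergent_prod, rule summable_imp_abs_convergent_prod)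
  have "summable (\<lambda>n. norm a * norm q ^ n)"
    using assms by (intro summable_mult summable_geometric) simp
  then show "summable (\<lambda>n. norm (1 - a * q ^ n - 1))"
    by (simp add: norm_mult norm_power)
qed

lemma qpochhammer_inf_LIMSEQ:
  assumes "norm q < 1"
  shows "(\<lambda>N. \<Prod>n<N. 1 - a * q ^ n) \<longlonglongrightarrow> qpochhammer_inf a q"
  unfolding qpochhammer_inf_def LIMSEQ_lessThan_iff_atMost
  by (rule convergent_prod_LIMSEQ[OF convergent_prod_qpochhammer[OF assms]])

lemma qpochhammer_inf_nonzero:
  assumes q: "norm q < 1" and a: "norm a < 1"
  shows "qpochhammer_inf a q \<noteq> 0"
  unfolding qpochhammer_inf_def
proof (rule prodinf_nonzero[OF convergent_prod_qpochhammer[OF q]])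
  fix n
  have "norm (q ^ n) \<le> 1"
    using q by (simp add: norm_power power_le_one)
  then have "norm (a * q ^ n) < 1"
    using a mult_right_le_one_le[of "norm a" "norm (q ^ n)"] by (simp add: norm_mult)
  then show "1 - a * q ^ n \<noteq> 0" by fastforce
qed

lemma euler_nonzero: "norm x < 1 \<Longrightarrow> euler x \<noteq> 0"
  by (simp add: euler_def qpochhammer_inf_nonzero)

text \<open>The factors \<open>1 - x ^ n\<close> of Euler's product split into those with
  \<open>n\<close> odd and those with \<open>n\<close> even.\<close>

lemma qpochhammer_odd:
  assumes x: "norm x < 1"
  shows "qpochhammer_inf x (x ^ 2) * euler (x ^ 2) = euler x"
proof -
  have x2: "norm (x ^ 2) < 1" by (rule norm_power_less_one[OF x]) simp
  have "(\<Prod>n<2 * N. 1 - x * x ^ n) = (\<Prod>n<N. 1 - x * (x ^ 2) ^ n) * (\<Prod>n<N. 1 - x ^ 2 * (x ^ 2) ^ n)" for N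
    by (induction N) (simp_all add: power_mult power2_eq_square algebra_simps flip: power_mult_distrib)
  moreover have "(\<lambda>N. \<Prod>n<2 * N. 1 - x * x ^ n) \<longlonglongrightarrow> euler x"
    unfolding euler_def
    by (rule filterlim_compose[OF qpochhammer_inf_LIMSEQ[OF x]])
      (rule mult_nat_left_at_top, simp)
  moreover have "(\<lambda>N. (\<Prod>n<N. 1 - x * (x ^ 2) ^ n) * (\<Prod>n<N. 1 - x ^ 2 * (x ^ 2) ^ n)) \<longlonglongrightarrow>
      qpochhammer_inf x (x ^ 2) * euler (x ^ 2)"
    unfolding euler_def by (intro tendsto_mult qpochhammer_inf_LIMSEQ[OF x2])
  ultimately show ?thesis by (simp add: LIMSEQ_unique)
qed

text \<open>Weierstrass test with majorant \<open>r * r ^ n\<close>. Uniform convergence on smaller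
  discs gives holomorphy of the limit and permits termwise logarithmic differentiation.\<close>

lemma uniform_limit_euler:
  assumes "r < 1"
  shows "uniform_limit (cball 0 r) (\<lambda>N x. \<Prod>n<N. 1 - x * x ^ n) euler sequentially"
proof -
  have "uniformly_convergent_on (cball 0 r) (\<lambda>N x::complex. \<Prod>n<N. 1 - x * x ^ n)"
  proof (rule uniformly_convergent_on_prod')
    show "uniformly_convergent_on (cball 0 r) (\<lambda>N x::complex. \<Sum>n<N. norm (1 - x * x ^ n - 1))"
    proof (cases "r < 0")
      case False
      show ?thesis
      proof (rule Weierstrass_m_test')
        show "norm (norm (1 - x * x ^ n - 1)) \<le> r * r ^ n" if "x \<in> cball 0 r" for n and x :: complex
          using that power_mono[of "norm x" r "Suc n"] by (simp add: norm_mult norm_power)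
        show "summable (\<lambda>n. r * r ^ n)"
          using assms False by (intro summable_mult summable_geometric) simp
      qed
    qed (simp add: uniformly_convergent_on_empty)
  qed (auto intro!: continuous_intros)
  then obtain l where l: "uniform_limit (cball 0 r) (\<lambda>N x::complex. \<Prod>n<N. 1 - x * x ^ n) l sequentially"
    by (auto simp: uniformly_convergent_on_def)
  have "l x = euler x" if x: "x \<in> cball 0 r" for x
  proof -
    have "norm x < 1" using x assms by simp
    from qpochhammer_inf_LIMSEQ[OF this, of x] tendsto_uniform_limitI[OF l x] show ?thesis
      unfolding euler_def by (rule LIMSEQ_unique[symmetric])
  qed
  then show ?thesis using l uniform_limit_cong' by (smt (verit, best))
qed

lemma holomorphic_euler: "euler holomorphic_on ball 0 1"
proof (rule holomorphic_uniform_sequence)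
  show "(\<lambda>x. \<Prod>n<N. 1 - x * x ^ n) holomorphic_on ball 0 1" for N
    by (intro holomorphic_intros)
  fix x :: complex assume x: "x \<in> ball 0 1"
  define d where "d = (1 - norm x) / 2"
  have "cball x d \<subseteq> cball 0 ((1 + norm x) / 2)"
  proof
    fix y assume "y \<in> cball x d"
    then show "y \<in> cball 0 ((1 + norm x) / 2)"
      using norm_triangle_ineq[of x "y - x"] by (simp add: d_def dist_norm norm_minus_commute field_simps)
  qed
  moreover from this have "cball x d \<subseteq> ball 0 1" using x by force
  ultimately show "\<exists>d>0. cball x d \<subseteq> ball 0 1 \<and>
      uniform_limit (cball x d) (\<lambda>N x. \<Prod>n<N. 1 - x * x ^ n) euler sequentially"
    using x uniform_limit_on_subset[OF uniform_limit_euler[of "(1 + norm x) / 2"]]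
    by (intro exI[of _ d]) (auto simp: d_def)
qed simp

section \<open>Lambert series as logarithmic derivatives\<close>

lemma euler_logderiv_sums:
  assumes x: "norm x < 1"
  shows "(\<lambda>n. of_nat (Suc n) * x ^ Suc n / (1 - x ^ Suc n)) sums (- x * deriv euler x / euler x)"
proof -
  obtain r where r: "norm x < r" "r < 1" using dense[OF x] by blast
  have "(\<lambda>k. deriv (\<lambda>x. 1 - x * x ^ k) x / (1 - x * x ^ k)) sums (deriv euler x / euler x)"
  proof (rule logderiv_prodinf_complex_uniform_limit)
    show "uniform_limit (ball 0 r) (\<lambda>n x. \<Prod>k<n. 1 - x * x ^ k) euler sequentially"
      by (rule uniform_limit_on_subset[OF uniform_limit_euler[OF r(2)]]) auto
    show "(\<lambda>x. 1 - x * x ^ k) holomorphic_on ball 0 r" for k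
      by (intro holomorphic_intros)
    show "euler x \<noteq> 0" by (rule euler_nonzero[OF x])
    show "x \<in> ball 0 r" using r by simp
  qed simp
  moreover have "deriv (\<lambda>x. 1 - x * x ^ k) x = - (of_nat (Suc k) * x ^ k)" for k
  proof (rule DERIV_imp_deriv)
    have "((\<lambda>x. 1 - x ^ Suc k) has_field_derivative 0 - of_nat (Suc k) * (1 * x ^ (Suc k - Suc 0))) (at x)"
      by (intro DERIV_diff DERIV_const DERIV_power DERIV_ident)
    then show "((\<lambda>x. 1 - x * x ^ k) has_field_derivative - (of_nat (Suc k) * x ^ k)) (at x)"
      by (simp del: of_nat_Suc)
  qed
  ultimately have "(\<lambda>k. - (of_nat (Suc k) * x ^ k) / (1 - x * x ^ k)) sums (deriv euler x / euler x)"
    by simp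
  from sums_mult[OF this, of "- x"] show ?thesis
    by (simp add: algebra_simps)
qed

text \<open>In the unit disc this is the generating series of the divisor sums \<sigma>(n), so
  \<open>1 - 24 * lambert x\<close> is the Eisenstein series E_2.\<close>

definition lambert :: "complex \<Rightarrow> complex" where
  "lambert x = (\<Sum>\<^sub>\<infinity>n\<in>{1::nat..}. x ^ n / (1 - x ^ n)\<^sup>2)"

lemma has_sum_geometric_deriv:
  fixes w :: "'a :: {real_normed_field, banach}"
  assumes "norm w < 1"
  shows "((\<lambda>i. of_nat (Suc i) * w ^ Suc i) has_sum (w / (1 - w)\<^sup>2)) UNIV"
proof (rule norm_summable_imp_has_sum)
  show "(\<lambda>i. of_nat (Suc i) * w ^ Suc i) sums (w / (1 - w)\<^sup>2)"
    using sums_mult[OF geometric_deriv_sums[OF assms], of w] by (simp add: algebra_simps)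
  have "(\<lambda>i. of_nat (Suc i) * norm w ^ i) sums (1 / (1 - norm w)\<^sup>2)"
    using assms by (intro geometric_deriv_sums) simp
  from summable_mult[OF sums_summable[OF this], of "norm w"]
  show "summable (\<lambda>i. norm (of_nat (Suc i) * w ^ Suc i))"
    by (simp add: norm_mult norm_power algebra_simps del: of_nat_Suc)
qed

text \<open>The double series of \<open>i * x ^ (i * j)\<close> over \<open>i, j \<ge> 1\<close> is
  summed in both orders: over \<open>j\<close> first it gives the logarithmic derivative of
  \<open>euler\<close>, over \<open>i\<close> first the Lambert series.\<close>

lemma has_sum_lambert_Suc:
  assumes x: "norm x < 1"
  shows "((\<lambda>n. x ^ Suc n / (1 - x ^ Suc n)\<^sup>2) has_sum (- x * deriv euler x / euler x)) UNIV"
proof -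
  define F where "F = (\<lambda>(i::nat, j::nat). of_nat (Suc i) * x ^ (Suc i * Suc j))"
  have row: "((\<lambda>j. y * z ^ Suc j) has_sum y * (z / (1 - z))) UNIV"
    if "norm z < 1" for y z :: "'a :: {real_normed_field, banach}"
  proof -
    have "summable (\<lambda>j. norm (z ^ Suc j))"
      using that summable_mult[OF summable_geometric[of "norm z"], of "norm z"]
      by (simp add: norm_mult norm_power)
    moreover have "(\<lambda>j. z ^ Suc j) sums (z / (1 - z))"
      using sums_mult[OF geometric_sums[OF that], of z] by simp
    ultimately show ?thesis
      by (intro has_sum_cmult_right norm_summable_imp_has_sum)
  qed
  have nx: "norm (x ^ Suc i) < 1" for i by (rule norm_power_less_one[OF x]) simp
  have "(\<lambda>(i, j). real (Suc i) * norm x ^ (Suc i * Suc j)) summable_on UNIV \<times> UNIV"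
  proof (rule summable_on_SigmaI)
    show "((\<lambda>j. case (i, j) of (i, j) \<Rightarrow> real (Suc i) * norm x ^ (Suc i * Suc j)) has_sum
        real (Suc i) * (norm x ^ Suc i / (1 - norm x ^ Suc i))) UNIV" for i
      using row[of "norm x ^ Suc i" "real (Suc i)"] nx[of i]
      by (simp only: power_mult prod.case norm_power real_norm_def abs_norm_cancel)
        (simp add: norm_power power_mult abs_mult)
    have "(\<lambda>i. real (Suc i) * norm x ^ Suc i * (1 / (1 - norm x))) summable_on UNIV"
      using x has_sum_geometric_deriv[of "norm x"]
      by (intro summable_on_cmult_left) (auto dest: has_sum_imp_summable)
    then show "(\<lambda>i. real (Suc i) * (norm x ^ Suc i / (1 - norm x ^ Suc i))) summable_on UNIV"
    proof (rule summable_on_comparison_test)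
      fix i
      have "norm x ^ Suc i \<le> norm x" using x power_decreasing[of 1 "Suc i" "norm x"] by simp
      then have "norm x ^ Suc i / (1 - norm x ^ Suc i) \<le> norm x ^ Suc i / (1 - norm x)"
        using x by (intro divide_left_mono) (auto intro!: mult_pos_pos)
      then show "real (Suc i) * (norm x ^ Suc i / (1 - norm x ^ Suc i)) \<le> real (Suc i) * norm x ^ Suc i * (1 / (1 - norm x))"
        by (metis mult.assoc mult_1_right times_divide_eq_right mult_left_mono of_nat_0_le_iff)
      show "0 \<le> real (Suc i) * (norm x ^ Suc i / (1 - norm x ^ Suc i))"
        using nx[of i] by (simp add: norm_power norm_mult)
    qed
  qed auto
  then have "(\<lambda>z. norm (F z)) summable_on UNIV \<times> UNIV"
    by (simp add: F_def case_prod_unfold norm_mult norm_power del: of_nat_Suc)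
  then have FS: "F summable_on UNIV \<times> UNIV" by (rule abs_summable_summable)
  then have F: "(F has_sum infsum F (UNIV \<times> UNIV)) (UNIV \<times> UNIV)" by (rule has_sum_infsum)
  have "((\<lambda>i. of_nat (Suc i) * (x ^ Suc i / (1 - x ^ Suc i))) has_sum infsum F (UNIV \<times> UNIV)) UNIV"
    by (rule has_sum_SigmaD[OF F]) (simp only: F_def prod.case power_mult row nx)
  then have "(\<lambda>i. of_nat (Suc i) * x ^ Suc i / (1 - x ^ Suc i)) sums infsum F (UNIV \<times> UNIV)"
    unfolding times_divide_eq_right by (rule has_sum_imp_sums)
  then have *: "infsum F (UNIV \<times> UNIV) = - x * deriv euler x / euler x"
    using euler_logderiv_sums[OF x] by (rule sums_unique2)
  have "((\<lambda>(j, i). F (i, j)) has_sum infsum F (UNIV \<times> UNIV)) (UNIV \<times> UNIV)"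
    using F by (subst (asm) has_sum_swap)
  then have "((\<lambda>j. x ^ Suc j / (1 - x ^ Suc j)\<^sup>2) has_sum infsum F (UNIV \<times> UNIV)) UNIV"
  proof (rule has_sum_SigmaD)
    fix j
    have "x ^ (Suc i * Suc j) = (x ^ Suc j) ^ Suc i" for i by (simp only: power_mult[symmetric] mult.commute)
    then show "((\<lambda>y. case (j, y) of (j, i) \<Rightarrow> F (i, j)) has_sum x ^ Suc j / (1 - x ^ Suc j)\<^sup>2) UNIV"
      using has_sum_geometric_deriv[OF nx[of j]] by (simp only: F_def prod.case)
  qed
  then show ?thesis by (simp only: *)
qed

lemma has_sum_lambert:
  assumes x: "norm x < 1"
  shows "((\<lambda>n. x ^ n / (1 - x ^ n)\<^sup>2) has_sum lambert x) {1..}"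
proof -
  have "((\<lambda>n. x ^ Suc n / (1 - x ^ Suc n)\<^sup>2) has_sum (- x * deriv euler x / euler x)) UNIV
      = ((\<lambda>n. x ^ n / (1 - x ^ n)\<^sup>2) has_sum (- x * deriv euler x / euler x)) {1..}"
    by (rule has_sum_reindex_bij_witness[where j = Suc and i = "\<lambda>n. n - 1"]) simp_all
  with has_sum_lambert_Suc[OF x] show ?thesis
    unfolding lambert_def by (intro has_sum_infsum has_sum_imp_summable) (simp only:)
qed

lemma lambert_eq_logderiv:
  assumes x: "norm x < 1"
  shows "lambert x = - x * deriv euler x / euler x"
proof -
  have "((\<lambda>n. x ^ Suc n / (1 - x ^ Suc n)\<^sup>2) has_sum lambert x) UNIV
      = ((\<lambda>n. x ^ n / (1 - x ^ n)\<^sup>2) has_sum lambert x) {1..}"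
    by (rule has_sum_reindex_bij_witness[where j = Suc and i = "\<lambda>n. n - 1"]) simp_all
  with has_sum_lambert[OF x] have "((\<lambda>n. x ^ Suc n / (1 - x ^ Suc n)\<^sup>2) has_sum lambert x) UNIV" by simp
  then show ?thesis using has_sum_lambert_Suc[OF x] by (rule has_sum_unique)
qed

text \<open>The terms of even index in the series for \<open>lambert x\<close> form the series for
  \<open>lambert (x ^ 2)\<close>; the odd ones that remain are those in
  \<open>z_fun\<close>.\<close>

lemma has_sum_lambert_odd:
  assumes x: "norm x < 1"
  shows "((\<lambda>n. x ^ (2 * n - 1) / (1 - x ^ (2 * n - 1))\<^sup>2) has_sum (lambert x - lambert (x ^ 2))) {1::nat..}"
proof -
  define h where "h = (\<lambda>n. x ^ n / (1 - x ^ n)\<^sup>2)"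
  define O' where "O' = {n::nat. odd n}"
  define E' where "E' = {n::nat. even n \<and> 1 \<le> n}"
  have un: "{1..} = O' \<union> E'" by (auto simp: O'_def E'_def Suc_le_eq odd_pos)
  have hs: "(h has_sum lambert x) {1..}" unfolding h_def by (rule has_sum_lambert[OF x])
  have "h summable_on O'"
    using has_sum_imp_summable[OF hs] by (rule summable_on_subset_banach) (simp only: un Un_upper1)
  then have o: "(h has_sum infsum h O') O'" by (rule has_sum_infsum)
  have "norm (x ^ 2) < 1" by (rule norm_power_less_one[OF x]) simp
  note has_sum_lambert[OF this]
  also have "((\<lambda>n. (x ^ 2) ^ n / (1 - (x ^ 2) ^ n)\<^sup>2) has_sum lambert (x ^ 2)) {1..} =
      (h has_sum lambert (x ^ 2)) E'"
    by (rule has_sum_reindex_bij_witness[where j = "\<lambda>n. 2 * n" and i = "\<lambda>n. n div 2"])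
      (auto simp: E'_def h_def power_mult)
  finally have e: "(h has_sum lambert (x ^ 2)) E'" .
  have "(h has_sum (infsum h O' + lambert (x ^ 2))) {1..}"
    unfolding un by (rule has_sum_Un_disjoint[OF o e]) (auto simp: O'_def E'_def)
  then have "infsum h O' + lambert (x ^ 2) = lambert x" using hs by (rule has_sum_unique)
  then have "infsum h O' = lambert x - lambert (x ^ 2)" by (simp add: algebra_simps)
  with o have "(h has_sum (lambert x - lambert (x ^ 2))) O'" by simp
  moreover have "((\<lambda>n. x ^ (2 * n - 1) / (1 - x ^ (2 * n - 1))\<^sup>2) has_sum (lambert x - lambert (x ^ 2))) {1::nat..}
      = (h has_sum (lambert x - lambert (x ^ 2))) O'"
    by (rule has_sum_reindex_bij_witness[where j = "\<lambda>n. 2 * n - 1" and i = "\<lambda>n. (n + 1) div 2"])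
      (auto simp: O'_def h_def)
  ultimately show ?thesis by simp
qed

text \<open>For odd \<open>n\<close> and \<open>w = x ^ n\<close>,
  \<open>w / (1 - w)^2 - w / (1 + w)^2 = 4 * w^2 / (1 - w^2)^2\<close>. So the odd-index parts at
  \<open>x\<close> and \<open>- x\<close> add up to four times the odd-index part at
  \<open>x ^ 2\<close>.\<close>

lemma lambert_add_minus:
  assumes x: "norm x < 1"
  shows "lambert x + lambert (- x) = 6 * lambert (x ^ 2) - 4 * lambert (x ^ 4)"
proof -
  have mx: "norm (- x) < 1" and x2: "norm (x ^ 2) < 1"
    using x norm_power_less_one[OF x, of 2] by auto
  have x4: "(x ^ 2) ^ 2 = x ^ 4" and mx2: "(- x) ^ 2 = x ^ 2" by simp_all
  have eq: "x ^ (2 * n - 1) / (1 - x ^ (2 * n - 1))\<^sup>2 + (- x) ^ (2 * n - 1) / (1 - (- x) ^ (2 * n - 1))\<^sup>2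
      = 4 * ((x ^ 2) ^ (2 * n - 1) / (1 - (x ^ 2) ^ (2 * n - 1))\<^sup>2)" if "n \<in> {1..}" for n
  proof -
    define w where "w = x ^ (2 * n - 1)"
    have n: "0 < 2 * n - 1" using that by simp
    have "norm w < 1" unfolding w_def by (rule norm_power_less_one[OF x n])
    then have nz: "1 - w \<noteq> 0" "1 + w \<noteq> 0"
      by (auto simp: add_eq_0_iff)
    have m: "(- x) ^ (2 * n - 1) = - w" using n by (simp add: w_def)
    have s: "(x ^ 2) ^ (2 * n - 1) = w * w"
      by (simp add: w_def power_mult[symmetric] power_add[symmetric] mult_2)
    have f: "1 - w * w = (1 - w) * (1 + w)" by (simp add: algebra_simps)
    show ?thesis
      unfolding m s f w_def[symmetric] using nz
      by (simp add: divide_simps power2_eq_square) (simp add: algebra_simps)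
  qed
  have "((\<lambda>n. 4 * ((x ^ 2) ^ (2 * n - 1) / (1 - (x ^ 2) ^ (2 * n - 1))\<^sup>2)) has_sum
      (lambert x - lambert (x ^ 2) + (lambert (- x) - lambert ((- x) ^ 2)))) {1..}"
    using has_sum_add[OF has_sum_lambert_odd[OF x] has_sum_lambert_odd[OF mx]]
    by (rule has_sum_cong[THEN iffD1, rotated]) (rule eq)
  moreover have "((\<lambda>n. 4 * ((x ^ 2) ^ (2 * n - 1) / (1 - (x ^ 2) ^ (2 * n - 1))\<^sup>2)) has_sum
      (4 * (lambert (x ^ 2) - lambert ((x ^ 2) ^ 2)))) {1..}"
    by (rule has_sum_cmult_right[OF has_sum_lambert_odd[OF x2]])
  ultimately have "lambert x - lambert (x ^ 2) + (lambert (- x) - lambert ((- x) ^ 2)) =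
      4 * (lambert (x ^ 2) - lambert ((x ^ 2) ^ 2))"
    by (rule has_sum_unique)
  then show ?thesis unfolding x4 mx2 by (simp add: algebra_simps)
qed

subsection \<open>Gauss's product formula\<close>

definition gauss_prod :: "complex \<Rightarrow> nat \<Rightarrow> complex" where
  "gauss_prod x n = (\<Prod>k<n. (1 - x ^ (2 * k + 2)) / (1 - x ^ (2 * k + 1)))"

lemma gauss_prod_nonzero:
  assumes "norm x < 1"
  shows "gauss_prod x n \<noteq> 0"
proof -
  have "1 - x ^ (2 * k + 2) \<noteq> 0" "1 - x ^ (2 * k + 1) \<noteq> 0" for k
    using power_neq_one[OF assms, of "2 * k + 2"] power_neq_one[OF assms, of "2 * k + 1"] by fastforce+
  then show ?thesis
    by (auto simp only: gauss_prod_def prod_zero_iff finite_lessThan divide_eq_0_iff)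
qed

lemma gauss_prod_LIMSEQ:
  assumes x: "norm x < 1"
  shows "gauss_prod x \<longlonglongrightarrow> euler (x ^ 2) ^ 2 / euler x"
proof -
  have x2: "norm (x ^ 2) < 1" by (rule norm_power_less_one[OF x]) simp
  have nz: "qpochhammer_inf x (x ^ 2) \<noteq> 0" by (rule qpochhammer_inf_nonzero[OF x2 x])
  have "(\<lambda>N. (\<Prod>n<N. 1 - x ^ 2 * (x ^ 2) ^ n) / (\<Prod>n<N. 1 - x * (x ^ 2) ^ n)) \<longlonglongrightarrow>
      euler (x ^ 2) / qpochhammer_inf x (x ^ 2)"
    unfolding euler_def by (intro tendsto_divide qpochhammer_inf_LIMSEQ x2 nz)
  moreover have "gauss_prod x = (\<lambda>N. (\<Prod>n<N. 1 - x ^ 2 * (x ^ 2) ^ n) / (\<Prod>n<N. 1 - x * (x ^ 2) ^ n))"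
  proof
    have "x ^ (2 * k + 2) = x ^ 2 * (x ^ 2) ^ k" "x ^ (2 * k + 1) = x * (x ^ 2) ^ k" for k
      by (simp_all add: power_add power_mult power2_eq_square)
    then show "gauss_prod x N = (\<Prod>n<N. 1 - x ^ 2 * (x ^ 2) ^ n) / (\<Prod>n<N. 1 - x * (x ^ 2) ^ n)" for N
      by (simp only: gauss_prod_def prod_dividef)
  qed
  ultimately have "gauss_prod x \<longlonglongrightarrow> euler (x ^ 2) / qpochhammer_inf x (x ^ 2)" by (simp only:)
  moreover have "euler (x ^ 2) / qpochhammer_inf x (x ^ 2) = euler (x ^ 2) ^ 2 / euler x"
    using qpochhammer_odd[OF x] euler_nonzero[OF x] euler_nonzero[OF x2] nz
    by (simp add: field_simps power2_eq_square)
  ultimately show ?thesis by simp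
qed

text \<open>
  Due to Shanks: passing from \<open>n\<close> to \<open>n + 1\<close> changes the summands on the right by \<open>U s - U (s - 1)\<close>.
\<close>

lemma gauss_finite_identity:
  assumes x: "norm x < 1"
  shows "(\<Sum>a\<in>{- int n..int n}. x ^ nat (tri a)) =
    (\<Sum>s\<le>n. gauss_prod x n / gauss_prod x s * x ^ (s * (2 * n + 1)))"
proof (induction n)
  case 0
  then show ?case by (simp add: tri_def gauss_prod_nonzero[OF x])
next
  case (Suc n)
  let ?P = "gauss_prod x"
  define T where "T = (\<lambda>n s. ?P n / ?P s * x ^ (s * (2 * n + 1)))"
  define U where "U = (\<lambda>s. ?P n / ?P s * (1 - x ^ (2 * s + 1)) * x ^ ((s + 1) * (2 * n + 1)) / (1 - x ^ (2 * n + 1)))"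
  have nz: "1 - x ^ Suc k \<noteq> 0" for k using power_neq_one[OF x, of "Suc k"] by simp
  have P: "?P (Suc k) = ?P k * (1 - x ^ (2 * k + 2)) / (1 - x ^ (2 * k + 1))" for k
    by (simp add: gauss_prod_def)
  have Pnz: "?P k \<noteq> 0" for k by (rule gauss_prod_nonzero[OF x])
  have "(\<Sum>s\<le>k. T (Suc n) s - T n s) = U k" for k
  proof (induction k)
    case 0
    have "x ^ (2 * n + 2) = x * x ^ (2 * n + 1)" by simp
    then show ?case
      using Pnz nz[of "2 * n"] by (simp add: T_def U_def P divide_simps) (simp add: algebra_simps)
  next
    case (Suc s)
    define y where "y = x ^ (2 * n + 1)"
    define v where "v = x ^ (2 * s + 1)"
    define w where "w = x ^ ((s + 1) * (2 * n + 1))"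
    have pw: "x ^ (Suc s * (2 * Suc n + 1)) = w * v * x" "x ^ (Suc s * (2 * n + 1)) = w"
      "x ^ (2 * Suc s + 1) = v * x * x" "x ^ ((Suc s + 1) * (2 * n + 1)) = w * y"
      "x ^ (2 * n + 2) = y * x" "x ^ (2 * s + 2) = v * x"
      by (simp_all add: w_def v_def y_def power_add[symmetric] power_Suc2[symmetric] algebra_simps)
    have y: "1 - y \<noteq> 0" and v: "1 - v \<noteq> 0" "1 - v * x \<noteq> 0"
      using nz[of "2 * n"] nz[of "2 * s"] nz[of "2 * s + 1"] by (simp_all add: y_def v_def algebra_simps)
    have "U s + (T (Suc n) (Suc s) - T n (Suc s)) = U (Suc s)"
      unfolding T_def U_def P pw y_def[symmetric] v_def[symmetric] w_def[symmetric]
      using y v Pnz[of n] Pnz[of s] by (simp add: divide_simps) (simp add: algebra_simps)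
    then show ?case by (simp add: Suc.IH)
  qed
  \<comment> \<open>What the telescoping leaves is the new summand of index \<open>- (n + 1)\<close>
    on the left; the new summand \<open>s = n + 1\<close> on the right supplies the one of index
    \<open>n + 1\<close>.\<close>
  moreover have "U n = x ^ ((n + 1) * (2 * n + 1))"
    unfolding U_def using Pnz[of n] nz[of "2 * n"]
    by (simp only: divide_self mult_1_left Suc_eq_plus1 nonzero_mult_div_cancel_left not_False_eq_True)
  ultimately have step: "(\<Sum>s\<le>n. T (Suc n) s) = (\<Sum>s\<le>n. T n s) + x ^ ((n + 1) * (2 * n + 1))"
    by (simp only: sum_subtractf diff_eq_eq add.commute)
  have set: "{- int (Suc n)..int (Suc n)} = insert (int (Suc n)) (insert (- int (Suc n)) {- int n..int n})"
    by auto
  have tri: "nat (tri (int (Suc n))) = Suc n * (2 * Suc n + 1)" "nat (tri (- int (Suc n))) = (n + 1) * (2 * n + 1)"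
  proof -
    have "tri (int (Suc n)) = int (Suc n * (2 * Suc n + 1))" "tri (- int (Suc n)) = int ((n + 1) * (2 * n + 1))"
      by (simp_all add: tri_def algebra_simps)
    then show "nat (tri (int (Suc n))) = Suc n * (2 * Suc n + 1)" "nat (tri (- int (Suc n))) = (n + 1) * (2 * n + 1)"
      by (simp_all only: nat_int)
  qed
  have "(\<Sum>a\<in>{- int (Suc n)..int (Suc n)}. x ^ nat (tri a)) =
      x ^ (Suc n * (2 * Suc n + 1)) + (x ^ ((n + 1) * (2 * n + 1)) + (\<Sum>a\<in>{- int n..int n}. x ^ nat (tri a)))"
    unfolding set by (subst sum.insert, simp, simp, subst sum.insert, simp, simp, simp only: tri)
  also have "\<dots> = (\<Sum>s\<le>Suc n. T (Suc n) s)"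
  proof -
    have "T (Suc n) (Suc n) = x ^ (Suc n * (2 * Suc n + 1))"
      unfolding T_def using Pnz[of "Suc n"] by (simp only: divide_self mult_1_left not_False_eq_True)
    moreover have "(\<Sum>s\<le>n. T n s) = (\<Sum>a\<in>{- int n..int n}. x ^ nat (tri a))"
      by (simp only: Suc.IH T_def)
    ultimately show ?thesis by (simp only: sum.atMost_Suc step add_ac)
  qed
  finally show ?case by (simp add: T_def)
qed

text \<open>In the finite identity the term \<open>s = 0\<close> is \<open>gauss_prod x n\<close>.
  The other terms have exponents at least \<open>n\<close> and bounded coefficients, so their sum
  tends to 0.\<close>

lemma psi_eq_euler:
  assumes x: "norm x < 1"
  shows "psi x = euler (x ^ 2) ^ 2 / euler x"
proof -
  let ?P = "gauss_prod x" and ?L = "euler (x ^ 2) ^ 2 / euler x"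
  have x2: "norm (x ^ 2) < 1" by (rule norm_power_less_one[OF x]) simp
  have L: "?L \<noteq> 0" using euler_nonzero[OF x] euler_nonzero[OF x2] by simp
  have P: "?P \<longlonglongrightarrow> ?L" by (rule gauss_prod_LIMSEQ[OF x])
  have "Bseq ?P" using P by (intro convergent_imp_Bseq convergentI)
  then obtain C where C0: "0 < C" and "\<forall>n. norm (?P n) \<le> C" by (rule BseqE)
  then have C: "norm (?P n) \<le> C" for n by simp
  have "Bseq (\<lambda>n. inverse (?P n))"
    using tendsto_inverse[OF P L] by (intro convergent_imp_Bseq convergentI)
  then obtain D where D0: "0 < D" and "\<forall>n. norm (inverse (?P n)) \<le> D" by (rule BseqE)
  then have D: "norm (inverse (?P n)) \<le> D" for n by simp
  \<comment> \<open>The symmetric intervals are cofinal among the finite sets of integers, so the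
    unordered sum is the limit along them.\<close>
  have "filterlim (\<lambda>n. {- int n..int n}) (finite_subsets_at_top UNIV) sequentially"
    unfolding filterlim_finite_subsets_at_top
  proof safe
    fix X :: "int set" assume "finite X"
    define b where "b = (\<Sum>a\<in>X. \<bar>a\<bar>)"
    have b: "\<bar>a\<bar> \<le> b" if "a \<in> X" for a
      unfolding b_def using that \<open>finite X\<close> by (intro member_le_sum) auto
    show "\<forall>\<^sub>F n in sequentially. finite {- int n..int n} \<and> X \<subseteq> {- int n..int n} \<and> {- int n..int n} \<subseteq> UNIV"
      using eventually_ge_at_top[of "nat b"]
    proof eventually_elim
      case (elim n)
      have "X \<subseteq> {- int n..int n}"
      proof
        fix a assume "a \<in> X"
        from b[OF this] elim have "- int n \<le> a \<and> a \<le> int n" by linarith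
        then show "a \<in> {- int n..int n}" by simp
      qed
      then show ?case by simp
    qed
  qed
  from filterlim_compose[OF has_sum_psi[OF x, unfolded has_sum_def] this]
  have "(\<lambda>n. \<Sum>a\<in>{- int n..int n}. x ^ nat (tri a)) \<longlonglongrightarrow> psi x" .
  then have R: "(\<lambda>n. \<Sum>s\<le>n. ?P n / ?P s * x ^ (s * (2 * n + 1))) \<longlonglongrightarrow> psi x"
    by (simp only: gauss_finite_identity[OF x])
  have "(\<lambda>n. (\<Sum>s\<le>n. ?P n / ?P s * x ^ (s * (2 * n + 1))) - ?P n) \<longlonglongrightarrow> 0"
  proof (rule Lim_null_comparison)
    show "(\<lambda>n. C * D * (of_nat n * norm x ^ n)) \<longlonglongrightarrow> 0"
      using powser_times_n_limit_0[of "norm x"] x by (intro tendsto_mult_right_zero) simp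
    show "\<forall>\<^sub>F n in sequentially. norm ((\<Sum>s\<le>n. ?P n / ?P s * x ^ (s * (2 * n + 1))) - ?P n)
        \<le> C * D * (of_nat n * norm x ^ n)"
    proof (rule always_eventually, rule allI)
      fix n
      have "(\<Sum>s\<le>n. ?P n / ?P s * x ^ (s * (2 * n + 1))) - ?P n =
          (\<Sum>s\<in>{1..n}. ?P n / ?P s * x ^ (s * (2 * n + 1)))"
      proof -
        have "{..n} = insert 0 {1..n}" by auto
        moreover have "?P 0 = 1" by (simp add: gauss_prod_def)
        ultimately show ?thesis by simp
      qed
      also have "norm \<dots> \<le> (\<Sum>s\<in>{1..n}. C * D * norm x ^ n)"
      proof (rule sum_norm_le)
        fix s assume s: "s \<in> {1..n}"
        have "1 * n \<le> s * (2 * n + 1)"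
          using s by (intro mult_le_mono) auto
        then have "norm x ^ (s * (2 * n + 1)) \<le> norm x ^ n"
          using x by (intro power_decreasing) auto
        then have "norm (?P n) * norm (inverse (?P s)) * norm x ^ (s * (2 * n + 1)) \<le> C * D * norm x ^ n"
          using C0 D0 by (intro mult_mono C D) auto
        then show "norm (?P n / ?P s * x ^ (s * (2 * n + 1))) \<le> C * D * norm x ^ n"
          by (simp add: norm_mult norm_power divide_inverse del: norm_inverse)
      qed
      finally show "norm ((\<Sum>s\<le>n. ?P n / ?P s * x ^ (s * (2 * n + 1))) - ?P n)
        \<le> C * D * (of_nat n * norm x ^ n)" by (simp add: mult_ac)
    qed
  qed
  from tendsto_add[OF this P] have "(\<lambda>n. \<Sum>s\<le>n. ?P n / ?P s * x ^ (s * (2 * n + 1))) \<longlonglongrightarrow> ?L" by simp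
  with R show ?thesis by (rule LIMSEQ_unique)
qed

subsection \<open>Logarithmic derivatives and Landen's transformation\<close>

lemma psi_nonzero:
  assumes "norm x < 1"
  shows "psi x \<noteq> 0"
  using psi_eq_euler[OF assms] euler_nonzero[OF assms] euler_nonzero[OF norm_power_less_one[OF assms, of 2]]
  by simp

lemma phi_eq_psi:
  assumes "norm x < 1"
  shows "phi x = psi x ^ 2 / psi (x ^ 2)"
  using psi_square[OF assms] psi_nonzero[OF norm_power_less_one[OF assms, of 2]] by (simp add: field_simps)

section \<open>Holomorphy and logarithmic differentiation in the unit disc\<close>

lemma power_in_ball: "x \<in> ball 0 1 \<Longrightarrow> 0 < k \<Longrightarrow> x ^ k \<in> ball (0::complex) 1"
  using norm_power_less_one[of x k] by simp

lemma holomorphic_compose_power: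
  assumes "f holomorphic_on ball 0 1" "0 < k"
  shows "(\<lambda>x. f (x ^ k)) holomorphic_on ball (0::complex) 1"
proof -
  have "f \<circ> (\<lambda>x. x ^ k) holomorphic_on ball 0 1"
  proof (rule holomorphic_on_compose_gen)
    show "(\<lambda>x. x ^ k) ` ball 0 1 \<subseteq> ball (0::complex) 1"
      using power_in_ball[OF _ assms(2)] by blast
  qed (intro holomorphic_intros assms)+
  then show ?thesis by (simp add: o_def)
qed

lemma holomorphic_compose_minus:
  assumes "f holomorphic_on ball 0 1"
  shows "(\<lambda>x. f (- x)) holomorphic_on ball (0::complex) 1"
proof -
  have "f \<circ> (\<lambda>x. - x) holomorphic_on ball 0 1"
  proof (rule holomorphic_on_compose_gen)
    show "(\<lambda>x. - x) ` ball 0 1 \<subseteq> ball (0::complex) 1" by auto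
  qed (intro holomorphic_intros assms)+
  then show ?thesis by (simp add: o_def)
qed

lemma holomorphic_psi: "psi holomorphic_on ball 0 1"
proof -
  have "(\<lambda>x. euler (x ^ 2)) holomorphic_on ball 0 1"
    by (intro holomorphic_compose_power holomorphic_euler) simp
  then have "(\<lambda>x. euler (x ^ 2) ^ 2 / euler x) holomorphic_on ball 0 1"
    by (intro holomorphic_intros holomorphic_euler) (simp_all add: euler_nonzero)
  then show ?thesis
    by (rule holomorphic_transform) (simp add: psi_eq_euler)
qed

lemma psi_0: "psi 0 = 1"
proof -
  have "qpochhammer_inf 0 0 = 1" by (simp add: qpochhammer_inf_def)
  then show ?thesis by (simp add: psi_eq_euler euler_def)
qed

text \<open>With the factor \<open>x\<close>, the logarithmic derivative of
  \<open>x \<mapsto> f (x ^ k)\<close> is \<open>k * dlog f (x ^ k)\<close>. The derivative rules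
  below are kept in the form \<open>f x * d / x\<close>, so that products and powers of theta values
  only add up their \<open>d\<close>.\<close>

definition dlog :: "(complex \<Rightarrow> complex) \<Rightarrow> complex \<Rightarrow> complex" where
  "dlog f x = x * deriv f x / f x"

lemma has_field_derivative_dlog:
  assumes "f holomorphic_on ball 0 1" "norm x < 1" "f x \<noteq> 0" "x \<noteq> 0"
  shows "(f has_field_derivative (f x * dlog f x / x)) (at x)"
proof -
  have "(f has_field_derivative deriv f x) (at x)"
    using assms by (intro holomorphic_derivI[of f "ball 0 1"]) auto
  moreover have "f x * dlog f x / x = deriv f x" using assms by (simp add: dlog_def)
  ultimately show ?thesis by simp
qed

lemma has_field_derivative_dlog_power:
  assumes f: "f holomorphic_on ball 0 1" and x: "norm x < 1" "x \<noteq> 0" and k: "0 < k" and nz: "f (x ^ k) \<noteq> 0"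
  shows "((\<lambda>x. f (x ^ k)) has_field_derivative (f (x ^ k) * (of_nat k * dlog f (x ^ k)) / x)) (at x)"
proof -
  have xk: "norm (x ^ k) < 1" by (rule norm_power_less_one[OF x(1) k])
  have "((\<lambda>x. f (x ^ k)) has_field_derivative
      (f (x ^ k) * dlog f (x ^ k) / x ^ k * (of_nat k * (1 * x ^ (k - Suc 0))))) (at x)"
  proof (rule DERIV_chain2[where f = f and g = "\<lambda>x. x ^ k"])
    show "(f has_field_derivative (f (x ^ k) * dlog f (x ^ k) / x ^ k)) (at (x ^ k))"
      using x by (intro has_field_derivative_dlog f xk nz) simp
  qed (intro DERIV_power DERIV_ident)
  moreover have "x ^ k = x ^ (k - Suc 0) * x" using k by (cases k) simp_all
  ultimately show ?thesis using x by (simp add: field_simps)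
qed

lemma has_field_derivative_dlog_minus:
  assumes f: "f holomorphic_on ball 0 1" and x: "norm x < 1" "x \<noteq> 0" and nz: "f (- x) \<noteq> 0"
  shows "((\<lambda>x. f (- x)) has_field_derivative (f (- x) * dlog f (- x) / x)) (at x)"
proof -
  have "((\<lambda>x. f (- x)) has_field_derivative (f (- x) * dlog f (- x) / (- x) * (- 1))) (at x)"
  proof (rule DERIV_chain2[where f = f and g = uminus])
    show "(f has_field_derivative (f (- x) * dlog f (- x) / (- x))) (at (- x))"
      using x by (intro has_field_derivative_dlog f nz) simp_all
  qed (intro DERIV_minus DERIV_ident)
  then show ?thesis by simp
qed

lemmas has_field_derivative_psi = has_field_derivative_dlog[OF holomorphic_psi]
lemmas has_field_derivative_psi_power = has_field_derivative_dlog_power[OF holomorphic_psi]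
lemmas has_field_derivative_psi_minus = has_field_derivative_dlog_minus[OF holomorphic_psi]

text \<open>Jacobi's identity theta_3^4 = theta_4^4 + theta_2^4, multiplied by
  \<open>psi (x ^ 2) ^ 4\<close>. By \<open>phi_square\<close>, \<open>phi x ^ 2\<close> and
  \<open>phi (- x) ^ 2\<close> have sum \<open>2 * phi (x ^ 2) ^ 2\<close> and difference
  \<open>8 * x * psi (x ^ 4) ^ 2\<close>.\<close>

lemma psi_8:
  assumes x: "norm x < 1"
  shows "psi x ^ 8 = psi (- x) ^ 8 + 16 * x * psi (x ^ 2) ^ 8"
proof -
  have mx: "norm (- x) < 1" and x2: "norm (x ^ 2) < 1"
    using x norm_power_less_one[OF x, of 2] by auto
  have e: "(- x) ^ 2 = x ^ 2" "(- x) ^ 4 = x ^ 4" "(x ^ 2) ^ 2 = x ^ 4" by simp_all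
  note p = psi_square[OF x] psi_square[OF mx, unfolded e] psi_square[OF x2, unfolded e]
    phi_square[OF x] phi_square[OF mx, unfolded e]
  have "psi x ^ 8 - psi (- x) ^ 8 = ((phi x ^ 2) ^ 2 - (phi (- x) ^ 2) ^ 2) * psi (x ^ 2) ^ 4"
    using p(1,2) by algebra
  also have "\<dots> = 16 * x * (phi (x ^ 2) * psi (x ^ 4)) ^ 2 * psi (x ^ 2) ^ 4"
    unfolding p(4,5) by algebra
  also have "\<dots> = 16 * x * psi (x ^ 2) ^ 8"
    unfolding p(3)[symmetric] by algebra
  finally show ?thesis by (simp add: algebra_simps)
qed

text \<open>Invariance under \<open>x \<mapsto> x\<^sup>2\<close> and continuity at \<open>0\<close> will force the quotient to be constant.\<close>

lemma landen_step:
  assumes x: "norm x < 1"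
  defines "L \<equiv> \<lambda>x. 1 + 8 * (2 * dlog psi (x ^ 2) - dlog psi x)"
  shows "L x / phi (- x) ^ 4 = L (x ^ 2) / phi (- (x ^ 2)) ^ 4"
proof (cases "x = 0")
  case False
  have mx: "norm (- x) < 1" and x2: "norm (x ^ 2) < 1" and x4: "norm (x ^ 4) < 1" and mx2: "norm (- (x ^ 2)) < 1"
    using x norm_power_less_one[OF x, of 2] norm_power_less_one[OF x, of 4] by auto
  have e: "(- x) ^ 2 = x ^ 2" "(- x) ^ 4 = x ^ 4" "(x ^ 2) ^ 2 = x ^ 4" by simp_all
  \<comment> \<open>Classically theta_2^2 / theta_3^2 at nome \<open>x ^ 2\<close>, that is, the
    modulus k there. Its logarithmic derivative is \<open>L (x ^ 2)\<close>.\<close>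
  define \<kappa> where "\<kappa> = (\<lambda>x. 4 * x * psi (x ^ 4) ^ 4 / psi (x ^ 2) ^ 4)"
  have nz: "psi x \<noteq> 0" "psi (x ^ 2) \<noteq> 0" "psi (x ^ 4) \<noteq> 0" "psi (- x) \<noteq> 0"
    by (rule psi_nonzero, fact)+
  have D: "(psi has_field_derivative psi x * dlog psi x / x) (at x)"
      "((\<lambda>x. psi (x ^ 2)) has_field_derivative psi (x ^ 2) * (2 * dlog psi (x ^ 2)) / x) (at x)"
      "((\<lambda>x. psi (x ^ 4)) has_field_derivative psi (x ^ 4) * (4 * dlog psi (x ^ 4)) / x) (at x)"
    using has_field_derivative_psi[OF x nz(1) False]
      has_field_derivative_psi_power[OF x False _ nz(2)] has_field_derivative_psi_power[OF x False _ nz(3)]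
    by simp_all
  have phi_kappa: "phi y ^ 2 = phi (y ^ 2) ^ 2 * (1 + \<kappa> y)" "\<kappa> y * phi (y ^ 2) ^ 2 = 4 * y * psi (y ^ 4) ^ 2" if y: "norm y < 1" for y
  proof -
    have y2: "norm (y ^ 2) < 1" using norm_power_less_one[OF y, of 2] by simp
    have y4: "norm (y ^ 4) < 1" using norm_power_less_one[OF y, of 4] by simp
    have "\<kappa> y * phi (y ^ 2) ^ 2 = 4 * y * psi (y ^ 4) ^ 2"
    proof -
      have "(y ^ 2) ^ 2 = y ^ 4" by simp
      then show ?thesis
        using psi_nonzero[OF y2] psi_nonzero[OF y4] phi_eq_psi[OF y2]
        by (simp add: \<kappa>_def divide_simps) algebra
    qed
    with phi_square[OF y] show "phi y ^ 2 = phi (y ^ 2) ^ 2 * (1 + \<kappa> y)" "\<kappa> y * phi (y ^ 2) ^ 2 = 4 * y * psi (y ^ 4) ^ 2"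
      by (simp_all add: algebra_simps)
  qed
  have k: "\<kappa> (- x) = - \<kappa> x" by (simp add: \<kappa>_def)
  have p: "phi x ^ 2 = phi (x ^ 2) ^ 2 * (1 + \<kappa> x)" "phi (- x) ^ 2 = phi (x ^ 2) ^ 2 * (1 - \<kappa> x)"
    using phi_kappa(1)[OF x] phi_kappa(1)[OF mx] by (simp_all add: k)
  have phinz: "phi y \<noteq> 0" if "norm y < 1" for y
    using phi_eq_psi[OF that] psi_nonzero[OF that] psi_nonzero[OF norm_power_less_one[OF that, of 2]] by simp
  have kp: "1 + \<kappa> x \<noteq> 0" using p(1) phinz[OF x] by auto
  have km: "1 - \<kappa> x \<noteq> 0" using p(2) phinz[OF mx] by auto
  have p4: "phi (- (x ^ 2)) ^ 4 = phi (x ^ 2) ^ 4 * (1 - \<kappa> x) * (1 + \<kappa> x)"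
  proof -
    have "phi (- (x ^ 2)) * psi (x ^ 4) = psi (- (x ^ 2)) ^ 2" "phi (x ^ 2) * psi (x ^ 4) = psi (x ^ 2) ^ 2"
      using phi_eq_psi[OF mx2] phi_eq_psi[OF x2] nz by simp_all
    with psi_8[OF x2, unfolded e]
    have "(phi (- (x ^ 2)) ^ 4 - (phi (x ^ 2) ^ 4 - 16 * x ^ 2 * psi (x ^ 4) ^ 4)) * psi (x ^ 4) ^ 4 = 0"
      by algebra
    then have "phi (- (x ^ 2)) ^ 4 = phi (x ^ 2) ^ 4 - 16 * x ^ 2 * psi (x ^ 4) ^ 4"
      using nz by simp
    also have "16 * x ^ 2 * psi (x ^ 4) ^ 4 = (\<kappa> x * phi (x ^ 2) ^ 2) ^ 2"
      unfolding phi_kappa(2)[OF x] by algebra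
    finally show ?thesis by algebra
  qed
  have dk: "(\<kappa> has_field_derivative \<kappa> x * L (x ^ 2) / x) (at x)"
    unfolding \<kappa>_def
    by (rule derivative_eq_intros D refl | use nz in force)+
      (use nz False in \<open>simp add: L_def divide_simps\<close>, algebra)
  \<comment> \<open>Landen's transformation: 16y \<psi>(y^2)^8 / \<psi>(y)^8 equals 4\<kappa> / (1 +
    \<kappa>)^2. Differentiating it yields
    \<open>L x * (1 + \<kappa> x) = L (x ^ 2) * (1 - \<kappa> x)\<close>.\<close>
  have FG: "16 * y * psi (y ^ 2) ^ 8 * (1 + \<kappa> y) ^ 2 = 4 * \<kappa> y * psi y ^ 8" if "y \<in> ball 0 1" for y
  proof -
    have y: "norm y < 1" and y2: "norm (y ^ 2) < 1"
      using that norm_power_less_one[of y 2] by simp_all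
    have "(y ^ 2) ^ 2 = y ^ 4" by simp
    then have "psi (y ^ 2) ^ 2 = phi (y ^ 2) * psi (y ^ 4)" using psi_square[OF y2] by simp
    then show ?thesis
      using psi_square[OF y] phi_kappa[OF y] by algebra
  qed
  have DF: "((\<lambda>y. 16 * y * psi (y ^ 2) ^ 8 * (1 + \<kappa> y) ^ 2) has_field_derivative
      (16 * x * psi (x ^ 2) ^ 8 * (1 + \<kappa> x) ^ 2 * (1 + 16 * dlog psi (x ^ 2)) +
       32 * x * psi (x ^ 2) ^ 8 * (1 + \<kappa> x) * \<kappa> x * L (x ^ 2)) / x) (at x)"
    by (rule derivative_eq_intros D dk refl)+
      (use False in \<open>simp add: field_simps\<close>, algebra)
  have DG: "((\<lambda>y. 4 * \<kappa> y * psi y ^ 8) has_field_derivative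
      (4 * \<kappa> x * psi x ^ 8 * (L (x ^ 2) + 8 * dlog psi x)) / x) (at x)"
    by (rule derivative_eq_intros D dk refl)+
      (use False in \<open>simp add: field_simps\<close>, algebra)
  have "((\<lambda>y. 4 * \<kappa> y * psi y ^ 8) has_field_derivative
      (16 * x * psi (x ^ 2) ^ 8 * (1 + \<kappa> x) ^ 2 * (1 + 16 * dlog psi (x ^ 2)) +
       32 * x * psi (x ^ 2) ^ 8 * (1 + \<kappa> x) * \<kappa> x * L (x ^ 2)) / x) (at x)"
    by (rule has_field_derivative_transform_within_open[OF DF, of "ball 0 1"]) (use x FG in auto)
  from DERIV_unique[OF this DG]
  have "16 * x * psi (x ^ 2) ^ 8 * (1 + \<kappa> x) ^ 2 * (1 + 16 * dlog psi (x ^ 2)) +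
       32 * x * psi (x ^ 2) ^ 8 * (1 + \<kappa> x) * \<kappa> x * L (x ^ 2) =
       4 * \<kappa> x * psi x ^ 8 * (L (x ^ 2) + 8 * dlog psi x)"
    using False by (simp only: divide_cancel_right simp_thms)
  moreover have "16 * x * psi (x ^ 2) ^ 8 * (1 + \<kappa> x) ^ 2 = 4 * \<kappa> x * psi x ^ 8"
    using x by (intro FG) simp
  moreover have "L x = 1 + 8 * (2 * dlog psi (x ^ 2) - dlog psi x)"
    by (simp only: L_def)
  ultimately have "(16 * x * psi (x ^ 2) ^ 8 * (1 + \<kappa> x)) * (L x * (1 + \<kappa> x) - L (x ^ 2) * (1 - \<kappa> x)) = 0"
    by algebra
  then have "L x * (1 + \<kappa> x) = L (x ^ 2) * (1 - \<kappa> x)"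
    using False nz kp by simp
  moreover have "phi (- x) ^ 4 = phi (x ^ 2) ^ 4 * (1 - \<kappa> x) ^ 2"
    using p(2) by algebra
  ultimately show ?thesis
    using kp km phinz[OF x2] unfolding p4 by (simp add: divide_simps power2_eq_square)
qed (simp add: L_def)

text \<open>The left side is the logarithmic derivative of 16x \<psi>(x^2)^8 / \<psi>(x)^8. Its
  quotient \<open>R\<close> by the right side is invariant under squaring, so it equals its value 1
  at 0, the limit along \<open>x ^ 2 ^ n\<close>.\<close>

lemma dlog_psi_landen:
  assumes x: "norm x < 1"
  shows "1 + 8 * (2 * dlog psi (x ^ 2) - dlog psi x) = phi (- x) ^ 4"
proof -
  define R where "R = (\<lambda>x. (1 + 8 * (2 * dlog psi (x ^ 2) - dlog psi x)) / phi (- x) ^ 4)"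
  have nz: "phi (- y) \<noteq> 0" if "norm y < 1" for y
  proof -
    have y: "norm (- y) < 1" using that by simp
    show ?thesis
      using phi_eq_psi[OF y] psi_nonzero[OF y] psi_nonzero[OF norm_power_less_one[OF y, of 2]] by simp
  qed
  have step: "R y = R (y ^ 2)" if "norm y < 1" for y
    using landen_step[OF that] by (simp only: R_def)
  have iter: "R x = R (x ^ 2 ^ n)" for n
  proof (induction n)
    case (Suc n)
    have "norm (x ^ 2 ^ n) < 1" by (rule norm_power_less_one[OF x]) simp
    from step[OF this] Suc.IH show ?case by (simp add: power_mult[symmetric] mult.commute)
  qed simp
  have dpsi: "dlog psi holomorphic_on ball 0 1"
    unfolding dlog_def
    by (intro holomorphic_intros holomorphic_deriv holomorphic_psi) (simp_all add: psi_nonzero)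
  have psi2: "(\<lambda>x. psi (x ^ 2)) holomorphic_on ball 0 1" "(\<lambda>x. dlog psi (x ^ 2)) holomorphic_on ball 0 1"
    "(\<lambda>x. psi (- x)) holomorphic_on ball 0 1"
    by (simp_all add: holomorphic_compose_power holomorphic_compose_minus holomorphic_psi dpsi)
  have "R holomorphic_on ball 0 1"
  proof (rule holomorphic_transform)
    show "(\<lambda>x. (1 + 8 * (2 * dlog psi (x ^ 2) - dlog psi x)) / (psi (- x) ^ 2 / psi (x ^ 2)) ^ 4) holomorphic_on ball 0 1"
      by (intro holomorphic_intros psi2 dpsi) (simp_all add: psi_nonzero norm_power_less_one)
    show "(1 + 8 * (2 * dlog psi (x ^ 2) - dlog psi x)) / (psi (- x) ^ 2 / psi (x ^ 2)) ^ 4 = R x"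
      if "x \<in> ball 0 1" for x
      using that phi_eq_psi[of "- x"] by (simp add: R_def)
  qed
  then have "isCont R 0"
    by (simp add: holomorphic_on_imp_continuous_on continuous_on_interior[of "ball 0 1"] interior_open)
  moreover have "(\<lambda>n. x ^ 2 ^ n) \<longlonglongrightarrow> 0"
  proof -
    have "strict_mono (\<lambda>n::nat. 2 ^ n :: nat)" by (simp add: strict_mono_def)
    from LIMSEQ_subseq_LIMSEQ[OF LIMSEQ_power_zero[OF x] this] show ?thesis by (simp add: o_def)
  qed
  ultimately have "(\<lambda>n. R (x ^ 2 ^ n)) \<longlonglongrightarrow> R 0"
    by (rule isCont_tendsto_compose)
  then have "R x = R 0"
    by (simp only: iter[symmetric] LIMSEQ_const_iff)
  also have "R 0 = 1" using phi_eq_psi[of 0] by (simp add: R_def dlog_def psi_0)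
  finally show ?thesis using nz[OF x] by (simp add: R_def field_simps)
qed

text \<open>Differentiate \<open>psi_8\<close> and remove \<open>dlog psi (x ^ 2)\<close> by
  \<open>dlog_psi_landen\<close>.\<close>

lemma dlog_psi_minus:
  assumes x: "norm x < 1"
  shows "dlog psi x - dlog psi (- x) = 2 * x * psi (x ^ 2) ^ 4"
proof (cases "x = 0")
  case False
  have mx: "norm (- x) < 1" and x2: "norm (x ^ 2) < 1"
    using x norm_power_less_one[OF x, of 2] by auto
  have nz: "psi x \<noteq> 0" "psi (x ^ 2) \<noteq> 0" "psi (- x) \<noteq> 0" by (rule psi_nonzero, fact)+
  have D: "(psi has_field_derivative psi x * dlog psi x / x) (at x)"
      "((\<lambda>x. psi (- x)) has_field_derivative psi (- x) * dlog psi (- x) / x) (at x)"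
      "((\<lambda>x. psi (x ^ 2)) has_field_derivative psi (x ^ 2) * (2 * dlog psi (x ^ 2)) / x) (at x)"
    using has_field_derivative_psi[OF x nz(1) False] has_field_derivative_psi_minus[OF x False nz(3)]
      has_field_derivative_psi_power[OF x False _ nz(2)] by simp_all
  have l: "((\<lambda>x. psi x ^ 8) has_field_derivative 8 * psi x ^ 8 * dlog psi x / x) (at x)"
    by (rule derivative_eq_intros D refl)+ (use False in \<open>simp add: field_simps\<close>, algebra)
  have r: "((\<lambda>x. psi (- x) ^ 8 + 16 * x * psi (x ^ 2) ^ 8) has_field_derivative
      (8 * psi (- x) ^ 8 * dlog psi (- x) + 16 * x * psi (x ^ 2) ^ 8 * (1 + 16 * dlog psi (x ^ 2))) / x) (at x)"
    by (rule derivative_eq_intros D refl)+ (use False in \<open>simp add: field_simps\<close>, algebra)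
  have "((\<lambda>x. psi x ^ 8) has_field_derivative
      (8 * psi (- x) ^ 8 * dlog psi (- x) + 16 * x * psi (x ^ 2) ^ 8 * (1 + 16 * dlog psi (x ^ 2))) / x) (at x)"
    by (rule has_field_derivative_transform_within_open[OF r, of "ball 0 1"]) (use x in \<open>simp_all add: psi_8[symmetric]\<close>)
  from DERIV_unique[OF l this]
  have "8 * psi x ^ 8 * dlog psi x =
      8 * psi (- x) ^ 8 * dlog psi (- x) + 16 * x * psi (x ^ 2) ^ 8 * (1 + 16 * dlog psi (x ^ 2))"
    using False by (simp only: divide_cancel_right simp_thms)
  moreover have "(1 + 8 * (2 * dlog psi (x ^ 2) - dlog psi x)) * psi (x ^ 2) ^ 4 = psi (- x) ^ 8"
    using dlog_psi_landen[OF x] phi_eq_psi[OF mx] nz by (simp add: power_divide flip: power_mult)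
  ultimately have "psi (- x) ^ 8 * (dlog psi x - dlog psi (- x) - 2 * x * psi (x ^ 2) ^ 4) * psi (x ^ 2) ^ 4 = 0"
    using psi_8[OF x] by algebra
  then show ?thesis using nz by simp
qed (simp add: dlog_def)

text \<open>
  In classical notation with nome \<open>x\<close>: \<open>modulus\<close> is \<open>\<alpha> = k\<^sup>2\<close>, \<open>theta4\<close> is \<open>\<theta>\<^sub>3\<^sup>4\<close>, and below
  \<open>tau7\<close> is \<open>(\<alpha>\<beta>)\<^bsup>1/8\<^esup>\<close> and \<open>mult7\<close> the multiplier \<open>\<theta>\<^sub>3(x)\<^sup>2 / \<theta>\<^sub>3(x\<^sup>7)\<^sup>2\<close> for \<open>\<beta>\<close> of degree seven over \<open>\<alpha>\<close>.
\<close>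

definition modulus :: "complex \<Rightarrow> complex" where
  "modulus x = 16 * x * psi (x ^ 2) ^ 8 / psi x ^ 8"

definition theta4 :: "complex \<Rightarrow> complex" where
  "theta4 x = psi x ^ 8 / psi (x ^ 2) ^ 4"

text \<open>In classical terms: \<alpha> theta_3^4 = theta_2^4, the complementary modulus from
  Jacobi's identity, and theta_4^4 as the logarithmic derivative of \<alpha>.\<close>

lemma
  assumes x: "norm x < 1"
  shows modulus_theta4: "modulus x * theta4 x = 16 * x * psi (x ^ 2) ^ 4"
    and one_minus_modulus: "1 - modulus x = psi (- x) ^ 8 / psi x ^ 8"
    and theta4_dlog: "(1 - modulus x) * theta4 x = 1 + 8 * (2 * dlog psi (x ^ 2) - dlog psi x)"
    and theta4_nonzero: "theta4 x \<noteq> 0"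
proof -
  have mx: "norm (- x) < 1" and x2: "norm (x ^ 2) < 1"
    using x norm_power_less_one[OF x, of 2] by auto
  have nz: "psi x \<noteq> 0" "psi (x ^ 2) \<noteq> 0" by (rule psi_nonzero, fact)+
  show "modulus x * theta4 x = 16 * x * psi (x ^ 2) ^ 4"
    unfolding modulus_def theta4_def using nz by (simp add: nonzero_divide_eq_eq)
  show e: "1 - modulus x = psi (- x) ^ 8 / psi x ^ 8"
  proof -
    have "1 - modulus x = (psi x ^ 8 - 16 * x * psi (x ^ 2) ^ 8) / psi x ^ 8"
      using nz by (simp add: modulus_def diff_divide_distrib)
    also have "psi x ^ 8 - 16 * x * psi (x ^ 2) ^ 8 = psi (- x) ^ 8"
      using psi_8[OF x] by simp
    finally show ?thesis .
  qed
  have "phi (- x) ^ 4 = psi (- x) ^ 8 / psi (x ^ 2) ^ 4"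
    using phi_eq_psi[OF mx] by (simp add: power_divide flip: power_mult)
  then show "(1 - modulus x) * theta4 x = 1 + 8 * (2 * dlog psi (x ^ 2) - dlog psi x)"
    using nz dlog_psi_landen[OF x] unfolding e by (simp add: theta4_def)
  show "theta4 x \<noteq> 0" using nz by (simp add: theta4_def)
qed

lemma holomorphic_modulus: "modulus holomorphic_on ball 0 1"
  unfolding modulus_def
  by (intro holomorphic_intros holomorphic_compose_power holomorphic_psi) (simp_all add: psi_nonzero)

lemma holomorphic_theta4: "theta4 holomorphic_on ball 0 1"
  unfolding theta4_def
  by (intro holomorphic_intros holomorphic_compose_power holomorphic_psi)
    (simp_all add: psi_nonzero norm_power_less_one)

lemma modulus_nonzero: "norm x < 1 \<Longrightarrow> x \<noteq> 0 \<Longrightarrow> modulus x \<noteq> 0"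
  by (simp add: modulus_def psi_nonzero norm_power_less_one)

lemma dlog_eqI:
  assumes "(f has_field_derivative f x * d / x) (at x)" "x \<noteq> 0" "f x \<noteq> 0"
  shows "dlog f x = d"
  using DERIV_imp_deriv[OF assms(1)] assms(2,3) by (simp add: dlog_def)

lemma dlog_modulus:
  assumes x: "norm x < 1" "x \<noteq> 0"
  shows "dlog modulus x = (1 - modulus x) * theta4 x"
proof (rule dlog_eqI)
  have x2: "norm (x ^ 2) < 1" using norm_power_less_one[OF x(1), of 2] by simp
  have nz: "psi x \<noteq> 0" "psi (x ^ 2) \<noteq> 0" by (rule psi_nonzero, fact)+
  have D: "(psi has_field_derivative psi x * dlog psi x / x) (at x)"
      "((\<lambda>x. psi (x ^ 2)) has_field_derivative psi (x ^ 2) * (2 * dlog psi (x ^ 2)) / x) (at x)"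
    using has_field_derivative_psi[OF x(1) nz(1) x(2)]
      has_field_derivative_psi_power[OF x _ nz(2)] by simp_all
  have "(modulus has_field_derivative
      modulus x * (1 + 8 * (2 * dlog psi (x ^ 2) - dlog psi x)) / x) (at x)"
    unfolding modulus_def[abs_def]
    by (rule derivative_eq_intros D refl | use nz in force)+
      (use nz x in \<open>simp add: divide_simps\<close>, algebra)
  then show "(modulus has_field_derivative modulus x * ((1 - modulus x) * theta4 x) / x) (at x)"
    by (simp only: theta4_dlog[OF x(1)])
qed (use x modulus_nonzero in auto)

text \<open>By continuity \<open>h\<close> has no zero near 0, so \<open>f\<close> vanishes on a
  punctured disc and hence everywhere by the identity theorem. This cancels factors that may vanish
  elsewhere in the disc and fixes the sign of a square root.\<close>

lemma holomorphic_cancel: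
  assumes "f holomorphic_on ball 0 1" "h holomorphic_on ball 0 1" "h 0 \<noteq> (0::complex)"
    and "\<And>x. norm x < 1 \<Longrightarrow> x \<noteq> 0 \<Longrightarrow> f x * h x = 0" and x: "norm x < 1"
  shows "f x = 0"
proof -
  have "isCont h 0"
    using assms(2) by (simp add: holomorphic_on_imp_continuous_on continuous_on_interior[of "ball 0 1"] interior_open)
  then obtain e where e: "0 < e" "\<And>y. dist 0 y < e \<Longrightarrow> h y \<noteq> 0"
    using continuous_at_avoid[of 0 h 0] assms(3) by (auto simp: dist_norm)
  define r where "r = min e 1"
  have "0 < r" using e by (simp add: r_def)
  have z: "f y = 0" if "y \<in> ball 0 r - {0}" for y
    using that assms(4)[of y] e(2)[of y] by (auto simp: r_def)
  show ?thesis
  proof (rule analytic_continuation_open[where f = f and g = "\<lambda>_. 0" and s = "ball 0 r - {0}" and s' = "ball 0 1"])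
    have "of_real (r / 2) \<in> ball (0::complex) r - {0}" using \<open>0 < r\<close> by simp
    then show "ball (0::complex) r - {0} \<noteq> {}" by blast
    show "ball (0::complex) r - {0} \<subseteq> ball 0 1" by (auto simp: r_def)
  qed (use assms(1) z x in auto)
qed

subsection \<open>The modular equation of degree seven\<close>

definition tau7 :: "complex \<Rightarrow> complex" where
  "tau7 x = 2 * x * psi (x ^ 2) * psi (x ^ 14) / (psi x * psi (x ^ 7))"

definition mult7 :: "complex \<Rightarrow> complex" where
  "mult7 x = psi x ^ 4 * psi (x ^ 14) ^ 2 / (psi (x ^ 2) ^ 2 * psi (x ^ 7) ^ 4)"

lemma power_7_2: "(x ^ 7) ^ 2 = x ^ 14" for x :: complex
  by (simp flip: power_mult)

lemma psi_nonzero_power: "norm x < 1 \<Longrightarrow> 0 < k \<Longrightarrow> psi (x ^ k) \<noteq> 0"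
  by (simp add: psi_nonzero norm_power_less_one)

lemma holomorphic_tau7: "tau7 holomorphic_on ball 0 1"
  unfolding tau7_def
  by (intro holomorphic_intros holomorphic_compose_power holomorphic_psi) (simp_all add: psi_nonzero psi_nonzero_power)

lemma holomorphic_mult7: "mult7 holomorphic_on ball 0 1"
  unfolding mult7_def
  by (intro holomorphic_intros holomorphic_compose_power holomorphic_psi) (simp_all add: psi_nonzero_power)

lemma mult7_nonzero: "norm x < 1 \<Longrightarrow> mult7 x \<noteq> 0"
  by (simp add: mult7_def psi_nonzero psi_nonzero_power)

lemma mult7_0: "mult7 0 = 1" and tau7_0: "tau7 0 = 0"
  by (simp_all add: mult7_def tau7_def psi_0)

lemma theta4_mult7:
  assumes x: "norm x < 1"
  shows "theta4 x = mult7 x ^ 2 * theta4 (x ^ 7)"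
  using psi_nonzero_power[OF x, of 2] psi_nonzero_power[OF x, of 7] psi_nonzero_power[OF x, of 14]
  by (simp add: theta4_def mult7_def power_7_2 power_divide power_mult_distrib flip: power_mult)

text \<open>Guetzlaff's modular equation. The second part is the eighth power of
  \<open>psi_degree_seven\<close>, read as 1 - t = \<psi>(-x) \<psi>(-x^7) / (\<psi>(x)
  \<psi>(x^7)).\<close>

lemma modulus_tau7:
  assumes x: "norm x < 1"
  shows "modulus x * modulus (x ^ 7) = tau7 x ^ 8"
    and "(1 - modulus x) * (1 - modulus (x ^ 7)) = (1 - tau7 x) ^ 8"
    and "tau7 x \<noteq> 1"
proof -
  have mx: "norm (- x) < 1" and x7: "norm (x ^ 7) < 1" using x norm_power_less_one[OF x, of 7] by auto
  have m7: "(- x) ^ 7 = - (x ^ 7)" by simp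
  note nz = psi_nonzero[OF x] psi_nonzero_power[OF x, of 7] psi_nonzero[OF mx] psi_nonzero_power[OF mx, of 7, unfolded m7]
  have "x ^ 8 = x * x ^ 7" by (simp flip: power_Suc)
  then have "16 * x * psi (x ^ 2) ^ 8 * (16 * x ^ 7 * psi (x ^ 14) ^ 8) = (2 * x * psi (x ^ 2) * psi (x ^ 14)) ^ 8"
    by (simp only: power_mult_distrib) simp
  then show "modulus x * modulus (x ^ 7) = tau7 x ^ 8"
    by (simp only: modulus_def tau7_def power_7_2 power_divide power_mult_distrib times_divide_times_eq)
  have "1 - tau7 x = psi (- x) * psi (- (x ^ 7)) / (psi x * psi (x ^ 7))"
    using psi_degree_seven[OF x] nz unfolding m7 tau7_def by (simp add: divide_simps) (simp add: algebra_simps)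
  then show "(1 - modulus x) * (1 - modulus (x ^ 7)) = (1 - tau7 x) ^ 8" "tau7 x \<noteq> 1"
    using nz by (auto simp: one_minus_modulus[OF x] one_minus_modulus[OF x7] power_divide power_mult_distrib)
qed

text \<open>The logarithmic derivative of t is one eighth of that of \<alpha>\<beta>. Comparing with
  the derivative of (1 - \<alpha>)(1 - \<beta>) = (1 - t)^8 gives the second relation.\<close>

lemma tau7_derivative:
  assumes x: "norm x < 1" "x \<noteq> 0"
  defines "Z \<equiv> theta4 x" and "Z' \<equiv> theta4 (x ^ 7)" and "\<alpha> \<equiv> modulus x" and "\<beta> \<equiv> modulus (x ^ 7)"
  shows "(tau7 has_field_derivative (tau7 x * ((1 - \<alpha>) * Z + 7 * (1 - \<beta>) * Z') / 8) / x) (at x)"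
    and "\<alpha> * Z + 7 * \<beta> * Z' = tau7 x * (Z + 7 * Z')"
proof -
  let ?d = "tau7 x * ((1 - \<alpha>) * Z + 7 * (1 - \<beta>) * Z') / 8"
  have x7: "norm (x ^ 7) < 1" "x ^ 7 \<noteq> 0" using x norm_power_less_one[OF x(1), of 7] by auto
  have nz: "psi x \<noteq> 0" "psi (x ^ 7) \<noteq> 0" "psi (x ^ 2) \<noteq> 0" "psi (x ^ 14) \<noteq> 0"
    using x by (simp_all add: psi_nonzero psi_nonzero_power)
  have D: "(psi has_field_derivative psi x * dlog psi x / x) (at x)"
      "((\<lambda>x. psi (x ^ 2)) has_field_derivative psi (x ^ 2) * (2 * dlog psi (x ^ 2)) / x) (at x)"
      "((\<lambda>x. psi (x ^ 7)) has_field_derivative psi (x ^ 7) * (7 * dlog psi (x ^ 7)) / x) (at x)"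
      "((\<lambda>x. psi (x ^ 14)) has_field_derivative psi (x ^ 14) * (14 * dlog psi (x ^ 14)) / x) (at x)"
    using has_field_derivative_psi[OF x(1) nz(1) x(2)] has_field_derivative_psi_power[OF x _ nz(2)]
      has_field_derivative_psi_power[OF x _ nz(3)] has_field_derivative_psi_power[OF x _ nz(4)] by simp_all
  have L: "(1 - \<alpha>) * Z = 1 + 8 * (2 * dlog psi (x ^ 2) - dlog psi x)"
      "(1 - \<beta>) * Z' = 1 + 8 * (2 * dlog psi (x ^ 14) - dlog psi (x ^ 7))"
    using theta4_dlog[OF x(1)] theta4_dlog[OF x7(1)] by (simp_all add: Z_def Z'_def \<alpha>_def \<beta>_def power_7_2)
  have "?d = tau7 x * (1 + 2 * dlog psi (x ^ 2) + 14 * dlog psi (x ^ 14) - dlog psi x - 7 * dlog psi (x ^ 7))"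
    by (simp only: mult.assoc L) (simp add: field_simps)
  moreover have "(tau7 has_field_derivative (tau7 x * (1 + 2 * dlog psi (x ^ 2) + 14 * dlog psi (x ^ 14) - dlog psi x - 7 * dlog psi (x ^ 7))) / x) (at x)"
    unfolding tau7_def[abs_def]
    by (rule derivative_eq_intros D refl | use nz in force)+
      (use nz x in \<open>simp add: divide_simps\<close>, algebra)
  ultimately show dt: "(tau7 has_field_derivative ?d / x) (at x)" by (simp only:)
  have da: "(modulus has_field_derivative \<alpha> * ((1 - \<alpha>) * Z) / x) (at x)"
    using has_field_derivative_dlog[OF holomorphic_modulus x(1) modulus_nonzero[OF x] x(2)] dlog_modulus[OF x]
    by (simp add: \<alpha>_def Z_def)
  have db: "((\<lambda>x. modulus (x ^ 7)) has_field_derivative \<beta> * (7 * ((1 - \<beta>) * Z')) / x) (at x)"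
    using has_field_derivative_dlog_power[OF holomorphic_modulus x _ modulus_nonzero[OF x7]] dlog_modulus[OF x7]
    by (simp add: \<beta>_def Z'_def)
  have l: "((\<lambda>x. (1 - modulus x) * (1 - modulus (x ^ 7))) has_field_derivative
      - ((1 - \<alpha>) * (1 - \<beta>) * (\<alpha> * Z + 7 * \<beta> * Z')) / x) (at x)"
    by (rule derivative_eq_intros da db refl)+
      (use x in \<open>simp add: \<alpha>_def[symmetric] \<beta>_def[symmetric] divide_simps\<close>, algebra)
  have r: "((\<lambda>x. (1 - tau7 x) ^ 8) has_field_derivative (- (8 * (1 - tau7 x) ^ 7 * ?d)) / x) (at x)"
    by (rule derivative_eq_intros dt refl)+ (use x in \<open>simp add: divide_simps\<close>)
  have "((\<lambda>x. (1 - tau7 x) ^ 8) has_field_derivative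
      - ((1 - \<alpha>) * (1 - \<beta>) * (\<alpha> * Z + 7 * \<beta> * Z')) / x) (at x)"
    by (rule has_field_derivative_transform_within_open[OF l, of "ball 0 1"]) (use x in \<open>simp_all add: modulus_tau7\<close>)
  from DERIV_unique[OF r this]
  have "8 * (1 - tau7 x) ^ 7 * ?d = (1 - tau7 x) ^ 8 * (\<alpha> * Z + 7 * \<beta> * Z')"
    using x by (simp add: modulus_tau7 \<alpha>_def \<beta>_def)
  then have "(1 - tau7 x) ^ 7 * (\<alpha> * Z + 7 * \<beta> * Z' - tau7 x * (Z + 7 * Z')) = 0"
    by algebra
  then show "\<alpha> * Z + 7 * \<beta> * Z' = tau7 x * (Z + 7 * Z')"
    using modulus_tau7(3)[OF x(1)] by simp
qed

text \<open>Put k = t(1 - t)(1 - t + t^2). The derivative relation reads m^2(\<alpha> - t) = 7(t -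
  \<beta>), and the modular equation gives (t - \<beta>)(\<alpha> - t) = 7k^2; so t - \<beta> is mk
  up to sign, and the behaviour at 0 selects the sign.\<close>

lemma mult7_modulus:
  assumes x: "norm x < 1"
  defines "t \<equiv> tau7 x" and "m \<equiv> mult7 x"
  shows "modulus (x ^ 7) = t - m * t * (1 - t) * (1 - t + t ^ 2)"
    and "m * modulus x = m * t + 7 * t * (1 - t) * (1 - t + t ^ 2)"
proof -
  define f where "f = (\<lambda>x. mult7 x * tau7 x * (1 - tau7 x) * (1 - tau7 x + tau7 x ^ 2) - (tau7 x - modulus (x ^ 7)))"
  \<comment> \<open>\<open>\<sigma>\<close> is t / x extended to 0, and \<open>h\<close> is the
    factor mk + (t - \<beta>) of the wrong sign, divided by x; \<open>h 0\<close> is 4.\<close>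
  define \<sigma> where "\<sigma> = (\<lambda>x. 2 * psi (x ^ 2) * psi (x ^ 14) / (psi x * psi (x ^ 7)))"
  define h where "h = (\<lambda>x. \<sigma> x * (mult7 x * (1 - tau7 x) * (1 - tau7 x + tau7 x ^ 2) + 1) - 16 * x ^ 6 * psi (x ^ 14) ^ 8 / psi (x ^ 7) ^ 8)"
  have star: "mult7 y ^ 2 * (modulus y - tau7 y) = 7 * (tau7 y - modulus (y ^ 7))" if y: "norm y < 1" "y \<noteq> 0" for y
  proof -
    have "theta4 (y ^ 7) \<noteq> 0" by (rule theta4_nonzero[OF norm_power_less_one[OF y(1)]]) simp
    moreover have "theta4 (y ^ 7) * (mult7 y ^ 2 * (modulus y - tau7 y) - 7 * (tau7 y - modulus (y ^ 7))) = 0"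
      using tau7_derivative(2)[OF y] unfolding theta4_mult7[OF y(1)] by algebra
    ultimately show ?thesis by simp
  qed
  have "f x = 0"
  proof (rule holomorphic_cancel[OF _ _ _ _ x])
    show "f holomorphic_on ball 0 1"
      unfolding f_def
      by (intro holomorphic_intros holomorphic_mult7 holomorphic_tau7 holomorphic_compose_power holomorphic_modulus) simp
    show "h holomorphic_on ball 0 1"
      unfolding h_def \<sigma>_def
      by (intro holomorphic_intros holomorphic_mult7 holomorphic_tau7 holomorphic_compose_power holomorphic_psi)
        (simp_all add: psi_nonzero psi_nonzero_power)
    show "h 0 \<noteq> 0" by (simp add: h_def \<sigma>_def mult7_0 tau7_0 psi_0)
    fix y :: complex assume y: "norm y < 1" "y \<noteq> 0"
    have s: "tau7 y = y * \<sigma> y" by (simp add: tau7_def \<sigma>_def)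
    have "y * (16 * y ^ 6 * psi (y ^ 14) ^ 8 / psi (y ^ 7) ^ 8) = modulus (y ^ 7)"
      by (simp add: modulus_def power_7_2 flip: power_Suc)
    then have "y * h y = mult7 y * tau7 y * (1 - tau7 y) * (1 - tau7 y + tau7 y ^ 2) + (tau7 y - modulus (y ^ 7))"
      unfolding h_def using s by (simp add: algebra_simps)
    then have "7 * y * (f y * h y) = 7 * ((mult7 y * tau7 y * (1 - tau7 y) * (1 - tau7 y + tau7 y ^ 2)) ^ 2 - (tau7 y - modulus (y ^ 7)) ^ 2)"
      unfolding f_def by algebra
    also have "\<dots> = 0"
    proof -
      define t where "t = tau7 y"
      define k where "k = t * (1 - t) * (1 - t + t ^ 2)"
      have "modulus y + modulus (y ^ 7) = 1 + t ^ 8 - (1 - t) ^ 8"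
        using modulus_tau7(1,2)[OF y(1)] unfolding t_def[symmetric] by algebra
      then have "(t - modulus (y ^ 7)) * (modulus y - t) = t * (1 + t ^ 8 - (1 - t) ^ 8) - t ^ 2 - t ^ 8"
        using modulus_tau7(1)[OF y(1)] unfolding t_def[symmetric] by algebra
      \<comment> \<open>The left side is t(1 - t)(1 - t^7 - (1 - t)^7); now use (a + b)^7 - a^7 -
        b^7 = 7ab(a + b)(a^2 + ab + b^2)^2 with a = t and b = 1 - t.\<close>
      also have "\<dots> = 7 * k ^ 2"
        unfolding k_def by algebra
      finally have "(t - modulus (y ^ 7)) * (modulus y - t) = 7 * k ^ 2" .
      then have "7 * ((mult7 y * k) ^ 2 - (t - modulus (y ^ 7)) ^ 2) = 0"
        using star[OF y] unfolding t_def[symmetric] by algebra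
      then show ?thesis
        by (simp only: k_def t_def mult.assoc)
    qed
    finally show "f y * h y = 0" using y by simp
  qed
  then show be: "modulus (x ^ 7) = t - m * t * (1 - t) * (1 - t + t ^ 2)"
    by (simp add: f_def t_def m_def)
  show "m * modulus x = m * t + 7 * t * (1 - t) * (1 - t + t ^ 2)"
  proof (cases "x = 0")
    case False
    have "m * (m * modulus x - (m * t + 7 * t * (1 - t) * (1 - t + t ^ 2))) = 0"
      using star[OF x False] be unfolding t_def m_def by algebra
    then show ?thesis using mult7_nonzero[OF x] by (simp add: m_def)
  qed (simp add: t_def tau7_0 modulus_def)
qed

lemma tau7_nonzero: "norm x < 1 \<Longrightarrow> x \<noteq> 0 \<Longrightarrow> tau7 x \<noteq> 0"
  by (simp add: tau7_def psi_nonzero psi_nonzero_power)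

text \<open>Insert both formulas of \<open>mult7_modulus\<close> into \<alpha>\<beta> = t^8. The
  surplus factor is t^2 (1 - t)(1 - t + t^2): t has no zero except at 0, and the rest is 1 at
  0.\<close>

lemma mult7_tau7:
  assumes x: "norm x < 1"
  shows "7 - mult7 x ^ 2 = (6 - 16 * tau7 x + 12 * tau7 x ^ 2 - 8 * tau7 x ^ 3) * mult7 x"
proof -
  have "7 - mult7 x ^ 2 - (6 - 16 * tau7 x + 12 * tau7 x ^ 2 - 8 * tau7 x ^ 3) * mult7 x = 0"
  proof (rule holomorphic_cancel[OF _ _ _ _ x])
    show "(\<lambda>x. (1 - tau7 x) * (1 - tau7 x + tau7 x ^ 2)) holomorphic_on ball 0 1"
      by (intro holomorphic_intros holomorphic_tau7)
    fix y :: complex assume y: "norm y < 1" "y \<noteq> 0"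
    define t where "t = tau7 y"
    define m where "m = mult7 y"
    have "t ^ 2 * ((7 - m ^ 2 - (6 - 16 * t + 12 * t ^ 2 - 8 * t ^ 3) * m) * ((1 - t) * (1 - t + t ^ 2))) = 0"
      using mult7_modulus[OF y(1)] modulus_tau7(1)[OF y(1)] unfolding t_def[symmetric] m_def[symmetric] by algebra
    then show "(7 - mult7 y ^ 2 - (6 - 16 * tau7 y + 12 * tau7 y ^ 2 - 8 * tau7 y ^ 3) * mult7 y) *
        ((1 - tau7 y) * (1 - tau7 y + tau7 y ^ 2)) = 0"
      using tau7_nonzero[OF y] unfolding t_def m_def by simp
  qed (intro holomorphic_intros holomorphic_mult7 holomorphic_tau7 | simp add: tau7_0)+
  then show ?thesis by simp
qed

text \<open>The left side is the logarithmic derivative of \<open>mult7\<close>, obtained by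
  differentiating the relation \<open>mult7_tau7\<close> between m and t.\<close>

lemma dlog_mult7:
  assumes x: "norm x < 1"
  defines "t \<equiv> tau7 x"
  shows "4 * dlog psi x - 4 * dlog psi (x ^ 2) - 28 * dlog psi (x ^ 7) + 28 * dlog psi (x ^ 14) =
    t * (1 - t) * (2 - 3 * t + 3 * t ^ 2) * mult7 x * theta4 (x ^ 7)"
proof -
  define M where "M = (\<lambda>x. 4 * dlog psi x - 4 * dlog psi (x ^ 2) - 28 * dlog psi (x ^ 7) + 28 * dlog psi (x ^ 14))"
  have dpsi: "dlog psi holomorphic_on ball 0 1"
    unfolding dlog_def
    by (intro holomorphic_intros holomorphic_deriv holomorphic_psi) (simp_all add: psi_nonzero)
  have "M x - tau7 x * (1 - tau7 x) * (2 - 3 * tau7 x + 3 * tau7 x ^ 2) * mult7 x * theta4 (x ^ 7) = 0"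
  proof (rule holomorphic_cancel[OF _ _ _ _ x])
    show "(\<lambda>x. M x - tau7 x * (1 - tau7 x) * (2 - 3 * tau7 x + 3 * tau7 x ^ 2) * mult7 x * theta4 (x ^ 7)) holomorphic_on ball 0 1"
      unfolding M_def
      by (intro holomorphic_intros holomorphic_mult7 holomorphic_tau7 holomorphic_compose_power holomorphic_theta4 dpsi) simp_all
    show "(\<lambda>x. mult7 x ^ 2 + 7) holomorphic_on ball 0 1"
      by (intro holomorphic_intros holomorphic_mult7)
    show "mult7 0 ^ 2 + 7 \<noteq> 0" by (simp add: mult7_0)
    fix x :: complex assume x: "norm x < 1" "x \<noteq> 0"
    define t where "t = tau7 x"
    define m where "m = mult7 x"
    define Z' where "Z' = theta4 (x ^ 7)"
    have nz: "psi x \<noteq> 0" "psi (x ^ 7) \<noteq> 0" "psi (x ^ 2) \<noteq> 0" "psi (x ^ 14) \<noteq> 0" "m \<noteq> 0"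
      using x by (simp_all add: psi_nonzero psi_nonzero_power m_def mult7_nonzero)
    have D: "(psi has_field_derivative psi x * dlog psi x / x) (at x)"
        "((\<lambda>x. psi (x ^ 2)) has_field_derivative psi (x ^ 2) * (2 * dlog psi (x ^ 2)) / x) (at x)"
        "((\<lambda>x. psi (x ^ 7)) has_field_derivative psi (x ^ 7) * (7 * dlog psi (x ^ 7)) / x) (at x)"
        "((\<lambda>x. psi (x ^ 14)) has_field_derivative psi (x ^ 14) * (14 * dlog psi (x ^ 14)) / x) (at x)"
      using has_field_derivative_psi[OF x(1) nz(1) x(2)] has_field_derivative_psi_power[OF x _ nz(2)]
        has_field_derivative_psi_power[OF x _ nz(3)] has_field_derivative_psi_power[OF x _ nz(4)] by simp_all
    have dm: "(mult7 has_field_derivative m * M x / x) (at x)"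
      unfolding mult7_def[abs_def] m_def M_def
      by (rule derivative_eq_intros D refl | use nz in force)+
        (use nz x in \<open>simp add: divide_simps\<close>, algebra)
    \<comment> \<open>With Z = \<open>theta4 x\<close>, \<alpha>Z + 7\<beta>Z' = t(Z + 7Z') and Z =
      m^2 Z' remove both moduli from the derivative of t.\<close>
    have "tau7 x * ((1 - modulus x) * theta4 x + 7 * (1 - modulus (x ^ 7)) * theta4 (x ^ 7)) / 8 =
        t * (1 - t) * (m ^ 2 + 7) * Z' / 8"
      using tau7_derivative(2)[OF x] theta4_mult7[OF x(1)]
      unfolding t_def[symmetric] m_def[symmetric] Z'_def[symmetric] divide_cancel_right by algebra
    with tau7_derivative(1)[OF x] have dt: "(tau7 has_field_derivative t * (1 - t) * (m ^ 2 + 7) * Z' / 8 / x) (at x)"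
      by (simp only:)
    have "((\<lambda>x. 7 - mult7 x ^ 2 - (6 - 16 * tau7 x + 12 * tau7 x ^ 2 - 8 * tau7 x ^ 3) * mult7 x) has_field_derivative
       m * (- (2 * m + 6 - 16 * t + 12 * t ^ 2 - 8 * t ^ 3) * M x + (2 - 3 * t + 3 * t ^ 2) * (t * (1 - t) * (m ^ 2 + 7) * Z')) / x) (at x)"
      by (rule derivative_eq_intros dm dt refl)+
        (use x in \<open>simp add: t_def[symmetric] m_def[symmetric] divide_simps\<close>, algebra)
    then have "((\<lambda>x. 0) has_field_derivative
       m * (- (2 * m + 6 - 16 * t + 12 * t ^ 2 - 8 * t ^ 3) * M x + (2 - 3 * t + 3 * t ^ 2) * (t * (1 - t) * (m ^ 2 + 7) * Z')) / x) (at x)"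
      by (rule has_field_derivative_transform_within_open[of _ _ _ "ball 0 1"]) (use x in \<open>simp_all add: mult7_tau7\<close>)
    from DERIV_unique[OF this DERIV_const]
    have "- (2 * m + 6 - 16 * t + 12 * t ^ 2 - 8 * t ^ 3) * M x + (2 - 3 * t + 3 * t ^ 2) * (t * (1 - t) * (m ^ 2 + 7) * Z') = 0"
      using x nz(5) by (simp only: divide_eq_0_iff mult_eq_0_iff[of m] simp_thms)
    \<comment> \<open>Multiplied by m, the coefficient 2m + 6 - 16t + 12t^2 - 8t^3 becomes m^2 + 7
      by the same relation.\<close>
    with mult7_tau7[OF x(1)] have "(M x - t * (1 - t) * (2 - 3 * t + 3 * t ^ 2) * m * Z') * (m ^ 2 + 7) = 0"
      unfolding t_def[symmetric] m_def[symmetric] by algebra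
    then show "(M x - tau7 x * (1 - tau7 x) * (2 - 3 * tau7 x + 3 * tau7 x ^ 2) * mult7 x * theta4 (x ^ 7)) * (mult7 x ^ 2 + 7) = 0"
      by (simp only: t_def m_def Z'_def)
  qed
  then show ?thesis by (simp add: M_def t_def)
qed

lemma dlog_psi_lambert:
  assumes x: "norm x < 1"
  shows "dlog psi x = lambert x - 4 * lambert (x ^ 2)"
proof (cases "x = 0")
  case True
  then show ?thesis using lambert_eq_logderiv[of 0] by (simp add: dlog_def)
next
  case False
  have x2: "norm (x ^ 2) < 1" using norm_power_less_one[OF x, of 2] by simp
  have l: "lambert y = - dlog euler y" if "norm y < 1" for y
    using lambert_eq_logderiv[OF that] by (simp add: dlog_def)
  note nz = euler_nonzero[OF x] euler_nonzero[OF x2]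
  have D: "(euler has_field_derivative euler x * dlog euler x / x) (at x)"
      "((\<lambda>x. euler (x ^ 2)) has_field_derivative euler (x ^ 2) * (2 * dlog euler (x ^ 2)) / x) (at x)"
    using has_field_derivative_dlog[OF holomorphic_euler x nz(1) False]
      has_field_derivative_dlog_power[OF holomorphic_euler x False _ nz(2)] by simp_all
  show ?thesis
  proof (rule dlog_eqI)
    have "((\<lambda>x. euler (x ^ 2) ^ 2 / euler x) has_field_derivative
        euler (x ^ 2) ^ 2 / euler x * (lambert x - 4 * lambert (x ^ 2)) / x) (at x)"
      unfolding l[OF x] l[OF x2]
      by (rule derivative_eq_intros D refl | use nz in force)+
        (use nz False in \<open>simp add: divide_simps\<close>, algebra)
    then have "((\<lambda>x. euler (x ^ 2) ^ 2 / euler x) has_field_derivative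
        psi x * (lambert x - 4 * lambert (x ^ 2)) / x) (at x)"
      by (simp only: psi_eq_euler[OF x])
    then show "(psi has_field_derivative psi x * (lambert x - 4 * lambert (x ^ 2)) / x) (at x)"
      by (rule has_field_derivative_transform_within_open[of _ _ _ "ball 0 1"])
        (use x in \<open>simp_all add: psi_eq_euler[symmetric]\<close>)
  qed (use False x in \<open>simp_all add: psi_nonzero\<close>)
qed

subsection \<open>Elimination\<close>

text \<open>Both combinations are linear in \<open>dlog psi\<close> at x, x^2, x^7, x^14 and in
  theta fourth powers. Landen's formula leaves only the combination of \<open>dlog_mult7\<close>,
  and the rest is expressed through m, t and Z'.\<close>

lemma eisenstein_quotients:
  assumes x: "norm x < 1"
  defines "t \<equiv> tau7 x" and "m \<equiv> mult7 x" and "Z' \<equiv> theta4 (x ^ 7)"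
  shows "4 * (lambert (x ^ 2) - 7 * lambert (x ^ 14)) + 1 = m * Z' * (1 - t + t ^ 2) ^ 2"
    and "16 * (lambert (x ^ 2) - lambert (x ^ 4) - 7 * (lambert (x ^ 14) - lambert (x ^ 28))) =
      m * Z' * t ^ 2 * (4 - 4 * t + 3 * t ^ 2)"
proof -
  \<comment> \<open>Here u - z/8 is \<open>dlog psi (- y)\<close>. Adding the Lambert expressions at
    y and -y and applying \<open>lambert_add_minus\<close> leaves two linear equations for
    \<open>lambert (y ^ 2)\<close> and \<open>lambert (y ^ 4)\<close>.\<close>
  have lin: "6 * lambert (y ^ 2) = 2 * v - 2 * (u + u - z / 8)" "12 * (lambert (y ^ 2) - lambert (y ^ 4)) = 6 * v - 3 * (2 * u - z / 8)"
    if y: "norm y < 1" and "u = dlog psi y" "v = dlog psi (y ^ 2)" "z = modulus y * theta4 y" for y u v z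
  proof -
    have my: "norm (- y) < 1" and y2: "norm (y ^ 2) < 1" using y norm_power_less_one[OF y, of 2] by auto
    have e: "(y ^ 2) ^ 2 = y ^ 4" "(- y) ^ 2 = y ^ 2" by simp_all
    have "z / 8 = 2 * y * psi (y ^ 2) ^ 4" using modulus_theta4[OF y] that by simp
    note l = dlog_psi_lambert[OF y] dlog_psi_lambert[OF my] dlog_psi_lambert[OF y2] lambert_add_minus[OF y]
      dlog_psi_minus[OF y]
    have "v = lambert (y ^ 2) - 4 * lambert (y ^ 4)" "u + (u - z / 8) = - 2 * lambert (y ^ 2) - 4 * lambert (y ^ 4)"
      using l \<open>z / 8 = _\<close> that(2,3) unfolding e by algebra+
    then show "6 * lambert (y ^ 2) = 2 * v - 2 * (u + u - z / 8)" "12 * (lambert (y ^ 2) - lambert (y ^ 4)) = 6 * v - 3 * (2 * u - z / 8)"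
      by (algebra, algebra)
  qed
  define u v u' v' where "u = dlog psi x" "v = dlog psi (x ^ 2)" "u' = dlog psi (x ^ 7)" "v' = dlog psi (x ^ 14)"
  note uv = this
  have x7: "norm (x ^ 7) < 1" by (rule norm_power_less_one[OF x]) simp
  have e: "(x ^ 7) ^ 2 = x ^ 14" "(x ^ 7) ^ 4 = x ^ 28" by (simp_all flip: power_mult)
  define z where "z = modulus x * theta4 x"
  define z' where "z' = modulus (x ^ 7) * Z'"
  note l = lin[OF x uv(1,2) z_def] lin[OF x7 uv(3) _ z'_def[unfolded Z'_def], of v', unfolded e, OF uv(4)]
  have th: "theta4 x = 1 + 8 * (2 * v - u) + z" "Z' = 1 + 8 * (2 * v' - u') + z'"
    using theta4_dlog[OF x] theta4_dlog[OF x7] unfolding e z_def z'_def Z'_def uv[symmetric] by algebra+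
  have M: "4 * u - 4 * v - 28 * u' + 28 * v' = t * (1 - t) * (2 - 3 * t + 3 * t ^ 2) * m * Z'" (is "?M = _")
    using dlog_mult7[OF x] unfolding uv t_def m_def Z'_def by simp
  have w: "6 * (4 * (lambert (x ^ 2) - 7 * lambert (x ^ 14)) + 1) =
      7 * (Z' - 2 * z') - (theta4 x - 2 * z) - 6 * ?M"
    and A: "32 * (lambert (x ^ 2) - lambert (x ^ 4) - 7 * (lambert (x ^ 14) - lambert (x ^ 28))) = z - 7 * z' - 4 * ?M"
    using l th by algebra+
  have zz: "z = m * (m * t + 7 * t * (1 - t) * (1 - t + t ^ 2)) * Z'" "z' = (t - m * t * (1 - t) * (1 - t + t ^ 2)) * Z'"
    "theta4 x = m ^ 2 * Z'" "7 - m ^ 2 = (6 - 16 * t + 12 * t ^ 2 - 8 * t ^ 3) * m"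
  proof -
    show "theta4 x = m ^ 2 * Z'" unfolding m_def Z'_def by (rule theta4_mult7[OF x])
    then show "z = m * (m * t + 7 * t * (1 - t) * (1 - t + t ^ 2)) * Z'"
      using mult7_modulus(2)[OF x] unfolding z_def m_def[symmetric] t_def[symmetric] by algebra
    show "z' = (t - m * t * (1 - t) * (1 - t + t ^ 2)) * Z'"
      unfolding z'_def m_def t_def by (simp only: mult7_modulus(1)[OF x])
    show "7 - m ^ 2 = (6 - 16 * t + 12 * t ^ 2 - 8 * t ^ 3) * m"
      unfolding m_def t_def by (rule mult7_tau7[OF x])
  qed
  show "4 * (lambert (x ^ 2) - 7 * lambert (x ^ 14)) + 1 = m * Z' * (1 - t + t ^ 2) ^ 2"
    using w unfolding M zz(1-3) using zz(4) by algebra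
  show "16 * (lambert (x ^ 2) - lambert (x ^ 4) - 7 * (lambert (x ^ 14) - lambert (x ^ 28))) =
      m * Z' * t ^ 2 * (4 - 4 * t + 3 * t ^ 2)"
    using A unfolding M zz(1-2) using zz(4) by algebra
qed

text \<open>The final equation in y = N / t^6 and f = F / (t^2 s), cleared of its denominator t^12
  s^3.\<close>

lemma modular_equation_numerator:
  fixes t :: complex
  defines "N \<equiv> 4 * (4 - 6 * t + 8 * t ^ 2 - 3 * t ^ 3) ^ 2 + 14 * t ^ 6"
  defines "s \<equiv> 4 - 4 * t + 3 * t ^ 2" and "F \<equiv> 16 * (1 - t + t ^ 2) ^ 2"
  shows "(N + 4 * t ^ 6) * F ^ 3 - (2 * N + 5 * t ^ 6) * F ^ 2 * (t ^ 2 * s)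
      - 2 * (5 * N + 22 * t ^ 6) * F * (t ^ 2 * s) ^ 2 - s ^ 3 * (N - 2 * t ^ 6) ^ 2 = 0"
  unfolding N_def s_def F_def by algebra

text \<open>\<open>G\<close> stands for g^2. Divided by G^2, the polynomial is invariant under G
  \<mapsto> 49/G, so it depends on G only through y = G + 49/G, which is rational in t.\<close>

lemma modular_equation_polynomial:
  fixes t m G f :: complex
  assumes t: "t \<noteq> 0" and G: "G * t ^ 6 = (m + 7 * (1 - t) * (1 - t + t ^ 2)) ^ 2"
    and m: "7 - m ^ 2 = (6 - 16 * t + 12 * t ^ 2 - 8 * t ^ 3) * m"
    and f: "f * (t ^ 2 * (4 - 4 * t + 3 * t ^ 2)) = 16 * (1 - t + t ^ 2) ^ 2" "4 - 4 * t + 3 * t ^ 2 \<noteq> 0"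
  shows "G * (G ^ 2 + 4 * G + 49) * f ^ 3 - G * (2 * G ^ 2 + 5 * G + 98) * f ^ 2
    - 2 * G * (5 * G ^ 2 + 22 * G + 245) * f - (G ^ 2 - 2 * G + 49) ^ 2 = 0"
proof -
  define h where "h = (1 - t) * (1 - t + t ^ 2)"
  define B where "B = 6 - 16 * t + 12 * t ^ 2 - 8 * t ^ 3"
  define N where "N = 4 * (4 - 6 * t + 8 * t ^ 2 - 3 * t ^ 3) ^ 2 + 14 * t ^ 6"
  define y where "y = N / t ^ 6"
  have hB: "1 - 7 * h ^ 2 + h * B = t ^ 6" "14 * h - B = 2 * (4 - 6 * t + 8 * t ^ 2 - 3 * t ^ 3)"
    unfolding h_def B_def by algebra+
  have G': "G * t ^ 6 = (m + 7 * h) ^ 2" using G unfolding h_def by algebra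
  have m': "7 - m ^ 2 = B * m" using m unfolding B_def .
  \<comment> \<open>The roots of m^2 + Bm - 7 have sum -B and product -7. So the two values of m +
    7h have product -7t^6 and sum 14h - B, and the other root corresponds to 49/G.\<close>
  have "(G ^ 2 + 49) * t ^ 12 = N * t ^ 6 * G"
  proof -
    have "((m + 7 * h) ^ 2) ^ 2 + 49 * (1 - 7 * h ^ 2 + h * B) ^ 2 =
        ((14 * h - B) ^ 2 + 14 * (1 - 7 * h ^ 2 + h * B)) * (m + 7 * h) ^ 2"
      using m' by algebra
    then have "(G * t ^ 6) ^ 2 + 49 * (t ^ 6) ^ 2 = ((14 * h - B) ^ 2 + 14 * t ^ 6) * (G * t ^ 6)"
      unfolding hB(1) G' .
    then show ?thesis unfolding hB(2) N_def by algebra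
  qed
  then have "t ^ 6 * ((G ^ 2 + 49) * t ^ 6 - N * G) = 0" by algebra
  then have "(G ^ 2 + 49) * t ^ 6 = N * G" using t by simp
  then have Gy: "G ^ 2 + 49 = y * G" using t by (simp add: y_def nonzero_eq_divide_eq)
  define s where "s = 4 - 4 * t + 3 * t ^ 2"
  define F where "F = 16 * (1 - t + t ^ 2) ^ 2"
  have s: "s \<noteq> 0" using f(2) by (simp add: s_def)
  have f': "f * (t ^ 2 * s) = F" using f(1) by (simp add: s_def F_def)
  have y: "y * t ^ 6 = N" using t by (simp add: y_def)
  have "t ^ 12 * s ^ 3 * ((y + 4) * f ^ 3 - (2 * y + 5) * f ^ 2 - 2 * (5 * y + 22) * f - (y - 2) ^ 2) =
      (y * t ^ 6 + 4 * t ^ 6) * (f * (t ^ 2 * s)) ^ 3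
      - (2 * (y * t ^ 6) + 5 * t ^ 6) * (f * (t ^ 2 * s)) ^ 2 * (t ^ 2 * s)
      - 2 * (5 * (y * t ^ 6) + 22 * t ^ 6) * (f * (t ^ 2 * s)) * (t ^ 2 * s) ^ 2
      - s ^ 3 * (y * t ^ 6 - 2 * t ^ 6) ^ 2"
    by algebra
  also have "\<dots> = 0"
    unfolding f' y unfolding N_def s_def F_def by (rule modular_equation_numerator)
  finally have Q: "(y + 4) * f ^ 3 - (2 * y + 5) * f ^ 2 - 2 * (5 * y + 22) * f - (y - 2) ^ 2 = 0"
    using t s by simp
  have p: "G ^ 2 + 4 * G + 49 = (y + 4) * G" "2 * G ^ 2 + 5 * G + 98 = (2 * y + 5) * G"
    "5 * G ^ 2 + 22 * G + 245 = (5 * y + 22) * G" "G ^ 2 - 2 * G + 49 = (y - 2) * G"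
    using Gy by algebra+
  have "G * (G ^ 2 + 4 * G + 49) * f ^ 3 - G * (2 * G ^ 2 + 5 * G + 98) * f ^ 2
    - 2 * G * (5 * G ^ 2 + 22 * G + 245) * f - (G ^ 2 - 2 * G + 49) ^ 2 =
    G ^ 2 * ((y + 4) * f ^ 3 - (2 * y + 5) * f ^ 2 - 2 * (5 * y + 22) * f - (y - 2) ^ 2)"
    unfolding p by algebra
  then show ?thesis unfolding Q by simp
qed

section \<open>From the functions of \<tau> to theta values at x\<close>

lemma qpochhammer_quotient:
  assumes x: "norm x < 1"
  shows "qpochhammer_inf (x ^ 2) (x ^ 2) / qpochhammer_inf x (x ^ 2) = psi x"
proof -
  have x2: "norm (x ^ 2) < 1" using norm_power_less_one[OF x, of 2] by simp
  show ?thesis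
    using qpochhammer_odd[OF x] euler_nonzero[OF x] euler_nonzero[OF x2] qpochhammer_inf_nonzero[OF x2 x]
    by (simp add: psi_eq_euler[OF x] euler_def field_simps power2_eq_square)
qed

theorem theorem1p2:
  fixes \<tau> :: complex
  assumes "Im \<tau> > 0"
    and "z_fun \<tau> \<noteq> 0"
  shows "let g = g_fun \<tau>; f = f_fun \<tau> in
    g^2 * (g^4 + 4 * g^2 + 49) * f^3
    - g^2 * (2 * g^4 + 5 * g^2 + 98) * f^2
    - 2 * g^2 * (5 * g^4 + 22 * g^2 + 245) * f
    - (g^2 - 4 * g + 7)^2 * (g^2 + 4 * g + 7)^2 = 0"
proof -
  define x where "x = exp (of_real pi * \<i> * \<tau>)"
  have x: "norm x < 1" "x \<noteq> 0"
    using assms(1) by (simp_all add: x_def)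
  have nome: "nome \<tau> = x ^ 2"
    unfolding nome_def x_def exp_of_nat_mult[symmetric] by (simp add: mult_ac)
  have q: "norm (x ^ 2) < 1" "norm (x ^ 14) < 1"
    by (rule norm_power_less_one[OF x(1)], simp)+
  have pow: "(x ^ 2) ^ 2 = x ^ 4" "(x ^ 2) ^ 7 = x ^ 14" "(x ^ 2) ^ 14 = x ^ 28" "(x ^ 14) ^ 2 = x ^ 28"
    by (simp_all flip: power_mult)
  \<comment> \<open>The claim involves g only through g^2, so the quarter powers of q occur squared
    and become integral powers of x.\<close>
  have qpow: "qpow (1 / 4) \<tau> ^ 2 = x" "qpow (7 / 4) \<tau> ^ 2 = x ^ 7"
    unfolding qpow_def x_def exp_of_nat_mult[symmetric] by (simp_all add: of_rat_divide mult_ac)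
  have Pi_q: "Pi_q \<tau> ^ 2 = x * psi (x ^ 2) ^ 4"
    using qpochhammer_quotient[OF q(1)]
    unfolding Pi_q_def Let_def nome pow by (simp add: power_mult_distrib qpow flip: power_divide power_mult)
  have Pi_q7: "Pi_q7 \<tau> ^ 2 = x ^ 7 * psi (x ^ 14) ^ 4"
    using qpochhammer_quotient[OF q(2)]
    unfolding Pi_q7_def Let_def nome pow by (simp add: power_mult_distrib qpow flip: power_divide power_mult)
  have nz: "psi (x ^ 2) \<noteq> 0" "psi (x ^ 14) \<noteq> 0" using x by (simp_all add: psi_nonzero_power)
  have Pi_q7_nz: "Pi_q7 \<tau> ^ 2 \<noteq> 0" using Pi_q7 x nz by simp
  define A where "A = lambert (x ^ 2) - lambert (x ^ 4) - 7 * (lambert (x ^ 14) - lambert (x ^ 28))"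
  define w where "w = 4 * (lambert (x ^ 2) - 7 * lambert (x ^ 14)) + 1"
  have odd: "(\<Sum>\<^sub>\<infinity>n\<in>{1::nat..}. (x ^ 2) ^ (2 * n - 1) / (1 - (x ^ 2) ^ (2 * n - 1))\<^sup>2) = lambert (x ^ 2) - lambert (x ^ 4)"
    using infsumI[OF has_sum_lambert_odd[OF q(1)]] by (simp only: pow)
  have "(\<Sum>\<^sub>\<infinity>n\<in>{1::nat..}. (x ^ 2) ^ (14 * n - 7) / (1 - (x ^ 2) ^ (14 * n - 7))\<^sup>2) =
      (\<Sum>\<^sub>\<infinity>n\<in>{1::nat..}. (x ^ 14) ^ (2 * n - 1) / (1 - (x ^ 14) ^ (2 * n - 1))\<^sup>2)"
  proof (rule infsum_cong)
    fix n :: nat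
    have "14 * n - 7 = 7 * (2 * n - 1)" by simp
    then have "(x ^ 2) ^ (14 * n - 7) = (x ^ 14) ^ (2 * n - 1)" by (simp only: power_mult pow)
    then show "(x ^ 2) ^ (14 * n - 7) / (1 - (x ^ 2) ^ (14 * n - 7))\<^sup>2 =
        (x ^ 14) ^ (2 * n - 1) / (1 - (x ^ 14) ^ (2 * n - 1))\<^sup>2" by (simp only:)
  qed
  also have "\<dots> = lambert (x ^ 14) - lambert (x ^ 28)"
    using infsumI[OF has_sum_lambert_odd[OF q(2)]] by (simp only: pow)
  finally have z: "z_fun \<tau> = 1 / Pi_q7 \<tau> ^ 2 * A"
    unfolding z_fun_def Let_def nome A_def odd by (simp only:)
  then have A0: "A \<noteq> 0" using assms(2) by auto
  have w: "w_fun \<tau> = w"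
    unfolding w_fun_def Let_def nome w_def lambert_def by (simp only: power_mult pow)
  have f: "f_fun \<tau> = w / A"
    unfolding f_fun_def z w using Pi_q7_nz by simp
  define t where "t = tau7 x"
  define m where "m = mult7 x"
  define Z where "Z = theta4 (x ^ 7)"
  have x7: "norm (x ^ 7) < 1" "x ^ 7 \<noteq> 0" using x norm_power_less_one[OF x(1), of 7] by simp_all
  have mZ: "m \<noteq> 0" "Z \<noteq> 0"
    using mult7_nonzero[OF x(1)] theta4_nonzero[OF x7(1)] by (simp_all add: m_def Z_def)
  have t0: "t \<noteq> 0" using tau7_nonzero[OF x] by (simp add: t_def)
  have wA: "w = m * Z * (1 - t + t ^ 2) ^ 2" "16 * A = m * Z * t ^ 2 * (4 - 4 * t + 3 * t ^ 2)"
    using eisenstein_quotients[OF x(1)] by (simp_all only: w_def A_def m_def Z_def t_def)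
  define G where "G = g_fun \<tau> ^ 2"
  have G: "G = x * psi (x ^ 2) ^ 4 / (x ^ 7 * psi (x ^ 14) ^ 4)"
    by (simp only: G_def g_fun_def power_divide Pi_q Pi_q7)
  have "modulus x * (m ^ 2 * Z) = 16 * x * psi (x ^ 2) ^ 4" "modulus (x ^ 7) * Z = 16 * x ^ 7 * psi (x ^ 14) ^ 4"
    using modulus_theta4[OF x(1)] modulus_theta4[OF x7(1)] theta4_mult7[OF x(1)]
    by (simp_all add: m_def Z_def power_7_2)
  moreover have "G * (x ^ 7 * psi (x ^ 14) ^ 4) = x * psi (x ^ 2) ^ 4" using G x nz by simp
  ultimately have "Z * (G * modulus (x ^ 7) - modulus x * m ^ 2) = 0" by algebra
  then have "G * modulus (x ^ 7) = modulus x * m ^ 2" using mZ by simp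
  \<comment> \<open>Multiply G\<beta> = \<alpha>m^2 by t^8 = \<alpha>\<beta>: the right side becomes
    \<beta>(m\<alpha>)^2, where \<open>mult7_modulus\<close> evaluates m\<alpha>.\<close>
  then have "modulus (x ^ 7) * t ^ 2 * (G * t ^ 6 - (m + 7 * (1 - t) * (1 - t + t ^ 2)) ^ 2) = 0"
    using modulus_tau7(1)[OF x(1)] mult7_modulus(2)[OF x(1)]
    unfolding t_def[symmetric] m_def[symmetric] by algebra
  then have Gt: "G * t ^ 6 = (m + 7 * (1 - t) * (1 - t + t ^ 2)) ^ 2"
    using t0 modulus_nonzero[OF x7] by simp
  \<comment> \<open>This is where the hypothesis on \<open>z_fun\<close> enters: it excludes the
    zeros of the denominator of f.\<close>
  have s0: "4 - 4 * t + 3 * t ^ 2 \<noteq> 0" using A0 wA(2) by auto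
  have "m * Z * (f_fun \<tau> * (t ^ 2 * (4 - 4 * t + 3 * t ^ 2)) - 16 * (1 - t + t ^ 2) ^ 2) = 0"
  proof -
    have "f_fun \<tau> * A = w" using f A0 by simp
    then show ?thesis using wA by algebra
  qed
  then have ft: "f_fun \<tau> * (t ^ 2 * (4 - 4 * t + 3 * t ^ 2)) = 16 * (1 - t + t ^ 2) ^ 2"
    using mZ by simp
  have "7 - m ^ 2 = (6 - 16 * t + 12 * t ^ 2 - 8 * t ^ 3) * m"
    unfolding m_def t_def by (rule mult7_tau7[OF x(1)])
  from modular_equation_polynomial[OF t0 Gt this ft s0]
  show ?thesis unfolding G_def Let_def by algebra
qed

end
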